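(* Let $n\ge1$ and let $\alpha_1,\dots,\alpha_{2n-1}\ge 0$ be integers with $\alpha_i=1$ for all even $i$. Let $G_A=G_X(\alpha_1,\alpha_2,\dots,\alpha_{2n-1})$ and $G_B=G_X(\alpha_1+1,\alpha_3+1,\dots,\alpha_{2n-1}+1)$; both graphs have $N:=n+\sum_{1\le i<j\le n}(\alpha_{2i-1}+1)(\alpha_{2j-1}+1)$ vertices. Fix any distinct $p_1,p_3,\dots,p_{2n-1}\in[N]$ and let $$A:=\{f\in\mathrm{Topo}(G_A): f(u_i)=p_i \text{ for all odd } i\},\qquad B:=\{f\in\mathrm{Topo}(G_B): f(u_i)=p_{2i-1}\text{ for all } i\in[n]\}.$$ Then there is a bijection $$\Big[\big(\textstyle\sum_{i=1}^{2n-1}\alpha_i\big)!\Big]\times A\;\longleftrightarrow\;\prod_{i=1}^{2n-1}[\alpha_i!]\times B.$$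
   Context: $[m]=\{1,\dots,m\}$. For a directed acyclic graph $G=(V,E)$, a topological ordering is a bijection $f:V\to[|V|]$ with $f(u)>f(v)$ for every edge $u\to v$, and $\mathrm{Topo}(G)$ is the set of topological orderings. For a tuple $\alpha=(\alpha_1,\dots,\alpha_m)$ of nonnegative integers, $G_X(\alpha)$ is the directed graph with vertices $u_1,\dots,u_m$ and $w_{i,j,k}$ for $1\le i<j\le m$, $k\in[\alpha_i\alpha_j]$, and edges $u_{i+1}\to u_i$ for $i\in[m-1]$ and $u_j\to w_{i,j,k}\to u_i$ for all $1\le i<j\le m$, $k\in[\alpha_i\alpha_j]$. *)

theory Defs
  imports "Graph_Theory.Pair_Digraph" "HOL-Library.FuncSet"
begin

(* Orderings are extensional, so that each bijection on the vertex set is represented exactly once.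
   An edge points from the larger label to the smaller one. *)
definition Topo :: "'a pair_pre_digraph \<Rightarrow> ('a \<Rightarrow> nat) set" where
  "Topo G = {f \<in> extensional (pverts G).
     bij_betw f (pverts G) {1..card (pverts G)} \<and>
     (\<forall>(u, v) \<in> parcs G. f u > f v)}"

datatype gx_vertex = U nat | W nat nat nat

(* The tuple is given by its length m and the values of alpha on {1..m}. *)
definition GX :: "nat \<Rightarrow> (nat \<Rightarrow> nat) \<Rightarrow> gx_vertex pair_pre_digraph" where
  "GX m \<alpha> = \<lparr>
     pverts = {U i | i. 1 \<le> i \<and> i \<le> m}
       \<union> {W i j k | i j k. 1 \<le> i \<and> i < j \<and> j \<le> m \<and> k \<in> {1..\<alpha> i * \<alpha> j}},
     parcs = {(U (i + 1), U i) | i. 1 \<le> i \<and> i + 1 \<le> m}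
       \<union> {(U j, W i j k) | i j k. 1 \<le> i \<and> i < j \<and> j \<le> m \<and> k \<in> {1..\<alpha> i * \<alpha> j}}
       \<union> {(W i j k, U i) | i j k. 1 \<le> i \<and> i < j \<and> j \<le> m \<and> k \<in> {1..\<alpha> i * \<alpha> j}}\<rparr>"

lemma pair_wf_digraph_GX: "pair_wf_digraph (GX m \<alpha>)"
  by unfold_locales (auto simp: GX_def)

lemma acyclic_GX: "acyclic (parcs (GX m \<alpha>))"
proof -
  define h where "h v = (case v of U i \<Rightarrow> 2 * i | W i j k \<Rightarrow> 2 * j - 1)" for v
  have "(parcs (GX m \<alpha>))\<inverse> \<subseteq> measure h"
    by (auto simp: GX_def h_def)
  then have "wf ((parcs (GX m \<alpha>))\<inverse>)"
    by (rule wf_subset[OF wf_measure])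
  then show ?thesis
    using wf_acyclic by (metis acyclic_converse)
qed

end

theory Submission
  imports Defs "Jordan_Normal_Form.Determinant"
begin

text \<open>
  Sort the vertices w into the gaps between consecutive vertices u. Orderings with prescribed gap
  sizes k are counted by the product of the k! times the coefficient of the monomial with exponents
  k, in the gap lengths, of the product of the (z_j - z_i)^(alpha_i alpha_j). In G_A only the
  positions of the odd u_i = x are prescribed, and forgetting the even ones, y, amounts to
  integrating each y over the interval between its two neighbours x, because the beta integral of
  (y - a)^k (b - y)^l is k! l! / (k + l + 1)! (b - a)^(k + l + 1). The integral over the interlacing
  y is the Dixon--Anderson integral, whose value is, up to the factorials in the statement, the
  product of the (x_j - x_i)^(a_i + a_j + 1); together with the factors (x_j - x_i)^(a_i a_j) this
  is the polynomial of G_B. Comparing coefficients gives equality of the cardinalities.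
\<close>

section \<open>Linear functionals on polynomials\<close>

text \<open>The y range over the box with y_i between x_i and x_(i+1), and both ways of expanding
  the integrand are sums of products of univariate polynomials. An identity between two such sums
  survives the application of a linear functional to each variable, be it integration or the reading
  of a coefficient, so neither multiple integrals nor multivariate polynomials have to be set up.
  Expanding the product of the y_j - y_i as a Vandermonde determinant turns the multiple integral
  into a determinant of one-dimensional ones, and the Dixon--Anderson formula becomes linear
  algebra.

  The beta integral fits the counting because gaps of sizes k and l around y leave exactly k + l + 1
  vertices between the two neighbours x, which is the exponent of b - a. The factor k! l! / (k + l +
  1)! is the quotient of the weight of two gaps of G_A by the weight of one gap of G_B.

  The exponents a_k carry signs instead of absolute values: k of the y lie to the left of x_k, which
  is the origin of (-1)^(k a_k).\<close>

definition linpoly :: "(real poly \<Rightarrow> real) \<Rightarrow> bool" where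
  "linpoly L \<longleftrightarrow> (\<forall>p q. L (p + q) = L p + L q) \<and> (\<forall>c p. L (smult c p) = c * L p)"

lemma linpoly_add: "linpoly L \<Longrightarrow> L (p + q) = L p + L q"
  and linpoly_smult: "linpoly L \<Longrightarrow> L (smult c p) = c * L p"
  by (auto simp: linpoly_def)

lemma linpoly_0: "linpoly L \<Longrightarrow> L 0 = 0"
  using linpoly_smult[of L 0 0] by simp

lemma linpoly_sum: "linpoly L \<Longrightarrow> L (\<Sum>i\<in>A. f i) = (\<Sum>i\<in>A. L (f i))"
  by (induction A rule: infinite_finite_induct) (auto simp: linpoly_0 linpoly_add)

lemma linpoly_poly: "linpoly (\<lambda>p. poly p x)"
  by (simp add: linpoly_def)

lemma linpoly_coeff: "linpoly (\<lambda>p. coeff p k)"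
  by (simp add: linpoly_def)

lemma linpoly_mult_right: "linpoly L \<Longrightarrow> linpoly (\<lambda>p. L (p * q))"
  by (simp add: linpoly_def distrib_right)

lemma linpoly_diff: "linpoly L \<Longrightarrow> linpoly M \<Longrightarrow> linpoly (\<lambda>p. L p - M p)"
  by (simp add: linpoly_def algebra_simps)

text \<open>The functionals are applied one variable at a time, the others being held fixed.\<close>
lemma linpoly_tensor:
  fixes m :: nat
  assumes lin: "\<And>i. i < m \<Longrightarrow> linpoly (L i)"
    and eq: "\<And>y. (\<Sum>r\<in>R. c r * (\<Prod>i<m. poly (f r i) (y i))) = (\<Sum>s\<in>S. d s * (\<Prod>i<m. poly (g s i) (y i)))"
  shows "(\<Sum>r\<in>R. c r * (\<Prod>i<m. L i (f r i))) = (\<Sum>s\<in>S. d s * (\<Prod>i<m. L i (g s i)))"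
  using assms
proof (induction m arbitrary: c d)
  case 0
  then show ?case by simp
next
  case (Suc m)
  have lm: "linpoly (L m)" using Suc.prems(1) by simp
  have "(\<Sum>r\<in>R. (c r * L m (f r m)) * (\<Prod>i<m. L i (f r i))) = (\<Sum>s\<in>S. (d s * L m (g s m)) * (\<Prod>i<m. L i (g s i)))"
  proof (rule Suc.IH)
    fix y
    \<comment> \<open>Both sides as polynomials in the last variable alone. They agree at every real
      \<open>t\<close>, hence are equal, and \<open>L m\<close> may be applied to them.\<close>
    define P where "P = (\<Sum>r\<in>R. smult (c r * (\<Prod>i<m. poly (f r i) (y i))) (f r m))"
    define Q where "Q = (\<Sum>s\<in>S. smult (d s * (\<Prod>i<m. poly (g s i) (y i))) (g s m))"
    have "poly P t = poly Q t" for t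
    proof -
      have "(\<Prod>i<m. poly (h i) ((y(m := t)) i)) = (\<Prod>i<m. poly (h i) (y i))" for h :: "nat \<Rightarrow> real poly"
        by (rule prod.cong) auto
      then show ?thesis
        using Suc.prems(2)[of "y(m := t)"] by (simp add: P_def Q_def poly_sum mult_ac)
    qed
    then have "P = Q"
      by (simp add: poly_eq_poly_eq_iff[symmetric] fun_eq_iff)
    then have "L m P = L m Q" by simp
    then show "(\<Sum>r\<in>R. (c r * L m (f r m)) * (\<Prod>i<m. poly (f r i) (y i)))
        = (\<Sum>s\<in>S. (d s * L m (g s m)) * (\<Prod>i<m. poly (g s i) (y i)))"
      by (simp add: P_def Q_def linpoly_sum[OF lm] linpoly_smult[OF lm] mult_ac)
  qed (use Suc.prems(1) in auto)
  then show ?case by (simp add: mult_ac)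
qed

text \<open>Reading off a coefficient is a linear functional in each variable, so
  \<open>linpoly_tensor\<close> isolates one monomial.\<close>

lemma monomial_sums_eq_imp_coeffs_eq:
  fixes m :: nat
  assumes "finite R" "finite S"
    and "\<And>t. (\<Sum>r\<in>R. c r * (\<Prod>i<m. t i ^ e r i)) = (\<Sum>s\<in>S. d s * (\<Prod>i<m. t i ^ h s i) :: real)"
  shows "(\<Sum>r | r \<in> R \<and> (\<forall>i<m. e r i = \<gamma> i). c r) = (\<Sum>s | s \<in> S \<and> (\<forall>i<m. h s i = \<gamma> i). d s)"
proof -
  have "(\<Sum>r\<in>R. c r * (\<Prod>i<m. coeff (monom 1 (e r i)) (\<gamma> i))) = (\<Sum>s\<in>S. d s * (\<Prod>i<m. coeff (monom 1 (h s i)) (\<gamma> i)))"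
    by (rule linpoly_tensor[where L = "\<lambda>i p. coeff p (\<gamma> i)"]) (auto simp: linpoly_coeff poly_monom assms)
  moreover have "(\<Prod>i<m. coeff (monom 1 (k i)) (\<gamma> i)) = (if \<forall>i<m. k i = \<gamma> i then 1 else 0 :: real)" for k
    by (auto intro!: prod.neutral)
  ultimately have "(\<Sum>r\<in>R. if \<forall>i<m. e r i = \<gamma> i then c r else 0) = (\<Sum>s\<in>S. if \<forall>i<m. h s i = \<gamma> i then d s else 0)"
    by (simp add: if_distrib[of "(*) _"] cong: if_cong del: coeff_monom)
  then show ?thesis
    using assms(1,2) by (simp add: sum.inter_filter)
qed

section \<open>The Dixon--Anderson integral\<close>

text \<open>The definite integral by way of an arbitrary antiderivative; antiderivatives differ by
  constants, so the choice cancels. The integral is signed, which makes the identities below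
  polynomial in the end points.\<close>

definition pint :: "real \<Rightarrow> real \<Rightarrow> real poly \<Rightarrow> real" where
  "pint a b p = (let q = SOME q. pderiv q = p in poly q b - poly q a)"

lemma pderiv_sum_poly: "pderiv (\<Sum>i\<in>A. f i) = (\<Sum>i\<in>A. pderiv (f i))"
  by (induction A rule: infinite_finite_induct) (auto simp: pderiv_add)

lemma ex_pderiv: "\<exists>q. pderiv q = (p :: real poly)"
proof
  show "pderiv (\<Sum>i\<le>degree p. monom (coeff p i / real (Suc i)) (Suc i)) = p"
    by (simp add: pderiv_sum_poly pderiv_monom poly_as_sum_of_monoms del: of_nat_Suc)
qed

lemma pint_pderiv: "pint a b (pderiv q) = poly q b - poly q a"
proof -
  define r where "r = (SOME r. pderiv r = pderiv q)"
  have "pderiv r = pderiv q"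
    unfolding r_def by (rule someI[of _ q]) simp
  then have "pderiv (r - q) = 0" by (simp add: pderiv_diff)
  then obtain h where "r - q = [:h:]" using pderiv_iszero by blast
  then have "r = q + [:h:]" by (metis add.commute diff_add_cancel)
  then show ?thesis by (simp add: pint_def r_def[symmetric])
qed

lemma linpoly_pint: "linpoly (pint a b)"
  unfolding linpoly_def
proof safe
  fix p q :: "real poly"
  obtain P Q where "p = pderiv P" "q = pderiv Q" using ex_pderiv by metis
  then show "pint a b (p + q) = pint a b p + pint a b q"
    by (simp add: pderiv_add[symmetric] pint_pderiv)
next
  fix c :: real and p :: "real poly"
  obtain P where "p = pderiv P" using ex_pderiv by metis
  then show "pint a b (smult c p) = c * pint a b p"
    by (simp add: pderiv_smult[symmetric] pint_pderiv algebra_simps)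
qed

text \<open>Integration by parts: (y - a)^(k + 1) (b - y)^(l + 1) vanishes at both ends, so a factor
  b - y can be traded for a factor y - a until l = 0.\<close>

lemma pint_beta:
  "pint a b ([:-a, 1:] ^ k * [:b, -1:] ^ l) = fact k * fact l / fact (k + l + 1) * (b - a) ^ (k + l + 1)"
proof (induction l arbitrary: k)
  case 0
  have "[:-a, 1:] ^ k = pderiv (smult (1 / real (Suc k)) ([:-a, 1:] ^ Suc k))"
    by (simp add: pderiv_smult pderiv_power_Suc pderiv_pCons del: power_Suc of_nat_Suc)
  then have "pint a b ([:-a, 1:] ^ k) = poly (smult (1 / real (Suc k)) ([:-a, 1:] ^ Suc k)) b - poly (smult (1 / real (Suc k)) ([:-a, 1:] ^ Suc k)) a"
    by (metis pint_pderiv)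
  then show ?case by (simp add: left_diff_distrib)
next
  case (Suc l)
  define u v where "u = [:-a, 1:]" and "v = [:b, -1:]"
  have d: "pderiv u = 1" "pderiv v = -1"
    by (auto simp: u_def v_def pderiv_pCons one_pCons)
  have "pderiv (u ^ Suc k * v ^ Suc l) = smult (real (Suc k)) (u ^ k * v ^ Suc l) + smult (- real (Suc l)) (u ^ Suc k * v ^ l)"
    by (simp add: pderiv_mult pderiv_power_Suc d algebra_simps del: power_Suc of_nat_Suc)
  then have "pint a b (smult (real (Suc k)) (u ^ k * v ^ Suc l) + smult (- real (Suc l)) (u ^ Suc k * v ^ l)) = 0"
    using pint_pderiv[of a b "u ^ Suc k * v ^ Suc l"] by (simp add: u_def v_def)
  then have "real (Suc k) * pint a b (u ^ k * v ^ Suc l) = real (Suc l) * pint a b (u ^ Suc k * v ^ l)"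
    unfolding linpoly_add[OF linpoly_pint] linpoly_smult[OF linpoly_pint] by (simp del: of_nat_Suc power_Suc)
  also have "\<dots> = real (Suc l) * (fact (Suc k) * fact l / fact (Suc k + l + 1) * (b - a) ^ (Suc k + l + 1))"
    using Suc.IH[of "Suc k"] by (simp add: u_def v_def)
  also have "\<dots> = real (Suc k) * (fact k * fact (Suc l) / fact (k + Suc l + 1) * (b - a) ^ (k + Suc l + 1))"
    by simp
  finally have "pint a b (u ^ k * v ^ Suc l) = fact k * fact (Suc l) / fact (k + Suc l + 1) * (b - a) ^ (k + Suc l + 1)"
    by (metis mult_left_cancel of_nat_neq_0)
  then show ?case unfolding u_def v_def .
qed

section \<open>Determinants of linear functionals in polynomial bases\<close>

text \<open>Writing the basis in powers of y factors the matrix through the unitriangular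
  coefficient matrix \<open>C\<close>. The rows may come from unrelated functionals, so evaluations
  and integrals can be mixed in one matrix; the bordering argument below relies on this.\<close>

lemma det_monic_basis:
  assumes lin: "\<And>i. i < n \<Longrightarrow> linpoly (L i)"
    and deg: "\<And>j. j < n \<Longrightarrow> degree (B j) \<le> j" and monic: "\<And>j. j < n \<Longrightarrow> coeff (B j) j = 1"
  shows "det (mat n n (\<lambda>(i, j). L i (B j))) = det (mat n n (\<lambda>(i, j). L i (monom 1 j)))"
proof -
  define M where "M = mat n n (\<lambda>(i, j). L i (monom 1 j))"
  define C where "C = mat n n (\<lambda>(k, j). coeff (B j) k)"
  have "mat n n (\<lambda>(i, j). L i (B j)) = M * C"
  proof (rule eq_matI)
    fix i j assume "i < dim_row (M * C)" "j < dim_col (M * C)"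
    then have ij: "i < n" "j < n" by (auto simp: M_def C_def)
    have "degree (B j) \<le> n - 1" using deg[OF ij(2)] ij by linarith
    then have "B j = (\<Sum>k\<le>n - 1. monom (coeff (B j) k) k)"
      by (simp add: poly_as_sum_of_monoms')
    also have "{..n - 1} = {0..<n}" using ij by auto
    finally have "B j = (\<Sum>k = 0..<n. smult (coeff (B j) k) (monom 1 k))"
      by (simp add: smult_monom)
    then have "L i (B j) = L i (\<Sum>k = 0..<n. smult (coeff (B j) k) (monom 1 k))" by simp
    also have "\<dots> = (\<Sum>k = 0..<n. coeff (B j) k * L i (monom 1 k))"
      by (simp add: linpoly_sum[OF lin[OF ij(1)]] linpoly_smult[OF lin[OF ij(1)]])
    also have "\<dots> = (M * C) $$ (i, j)"
      using ij by (simp add: M_def C_def scalar_prod_def mult.commute)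
    finally show "mat n n (\<lambda>(i, j). L i (B j)) $$ (i, j) = (M * C) $$ (i, j)"
      using ij by simp
  qed (auto simp: M_def C_def)
  moreover have "det (M * C) = det M * det C"
    by (rule det_mult[of _ n]) (auto simp: M_def C_def)
  moreover have "det C = prod_list (diag_mat C)"
  proof (rule det_upper_triangular[of _ n])
    show "upper_triangular C"
      using deg by (auto simp: C_def upper_triangular_def intro!: coeff_eq_0) (meson le_less_trans less_trans)
  qed (simp add: C_def)
  moreover have "prod_list (diag_mat C) = 1"
    unfolding prod_list_diag_prod by (rule prod.neutral) (auto simp: C_def monic)
  ultimately show ?thesis by (simp add: M_def)
qed

lemma degree_prod_linear: "finite A \<Longrightarrow> degree (\<Prod>k\<in>A. [:- y k, 1 :: real:]) = card A"
  by (subst degree_prod_eq_sum_degree) auto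

lemma coeff_prod_linear: "finite A \<Longrightarrow> coeff (\<Prod>k\<in>A. [:- y k, 1 :: real:]) (card A) = 1"
  using lead_coeff_prod[of "\<lambda>k. [:- y k, 1:]" A] by (simp add: degree_prod_linear)

lemma vandermonde:
  "det (mat n n (\<lambda>(i, j). y i ^ j)) = (\<Prod>i<n. \<Prod>k<i. y i - y k :: real)"
proof -
  \<comment> \<open>In the Newton basis the matrix is triangular.\<close>
  define B where "B j = (\<Prod>k<j. [:- y k, 1:])" for j
  have "det (mat n n (\<lambda>(i, j). y i ^ j)) = det (mat n n (\<lambda>(i, j). poly (monom 1 j) (y i)))"
    by (simp add: poly_monom)
  also have "\<dots> = det (mat n n (\<lambda>(i, j). poly (B j) (y i)))"
    using degree_prod_linear[of "{..<j}" y for j] coeff_prod_linear[of "{..<j}" y for j]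
    by (intro det_monic_basis[symmetric]) (auto simp: linpoly_poly B_def)
  also have "\<dots> = prod_list (diag_mat (mat n n (\<lambda>(i, j). poly (B j) (y i))))"
    by (rule det_lower_triangular[of n]) (auto simp: B_def poly_prod prod_zero_iff)
  also have "\<dots> = (\<Prod>i<n. \<Prod>k<i. y i - y k)"
    unfolding prod_list_diag_prod by (simp add: B_def poly_prod atLeast0LessThan)
  finally show ?thesis .
qed

lemma det_first_row:
  fixes A :: "real mat"
  assumes A: "A \<in> carrier_mat (Suc d) (Suc d)" and z: "\<And>j. 0 < j \<Longrightarrow> j < Suc d \<Longrightarrow> A $$ (0, j) = 0"
  shows "det A = A $$ (0, 0) * det (mat d d (\<lambda>(i, j). A $$ (Suc i, Suc j)))"
proof -
  have "det A = (\<Sum>j<Suc d. A $$ (0, j) * cofactor A 0 j)"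
    by (rule laplace_expansion_row[OF A]) simp
  also have "\<dots> = A $$ (0, 0) * cofactor A 0 0"
    by (simp only: sum.lessThan_Suc_shift) (simp add: z)
  also have "mat_delete A 0 0 = mat d d (\<lambda>(i, j). A $$ (Suc i, Suc j))"
    using A by (auto simp: mat_delete_def)
  then have "cofactor A 0 0 = det (mat d d (\<lambda>(i, j). A $$ (Suc i, Suc j)))"
    by (simp add: cofactor_def)
  finally show ?thesis .
qed

lemma det_last_col:
  fixes A :: "real mat"
  assumes A: "A \<in> carrier_mat (Suc d) (Suc d)" and z: "\<And>i. 0 < i \<Longrightarrow> i < Suc d \<Longrightarrow> A $$ (i, d) = 0"
  shows "det A = (-1) ^ d * A $$ (0, d) * det (mat d d (\<lambda>(i, j). A $$ (Suc i, j)))"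
proof -
  have "det A = (\<Sum>i<Suc d. A $$ (i, d) * cofactor A i d)"
    by (rule laplace_expansion_column[OF A]) simp
  also have "\<dots> = A $$ (0, d) * cofactor A 0 d"
    by (simp only: sum.lessThan_Suc_shift) (simp add: z)
  also have "mat_delete A 0 d = mat d d (\<lambda>(i, j). A $$ (Suc i, j))"
    using A by (auto simp: mat_delete_def intro!: eq_matI)
  then have "cofactor A 0 d = (-1) ^ d * det (mat d d (\<lambda>(i, j). A $$ (Suc i, j)))"
    by (simp add: cofactor_def)
  finally show ?thesis by simp
qed

lemma det_scale_rows:
  "det (mat d d (\<lambda>(i, j). c i * f i j)) = (\<Prod>i<d. c i :: real) * det (mat d d (\<lambda>(i, j). f i j))"
proof -
  have "signof p * (\<Prod>i = 0..<d. mat d d (\<lambda>(i, j). c i * f i j) $$ (i, p i))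
      = (\<Prod>i<d. c i) * (signof p * (\<Prod>i = 0..<d. mat d d (\<lambda>(i, j). f i j) $$ (i, p i)))"
    if "p permutes {0..<d}" for p
    using permutes_in_image[OF that] by (simp add: prod.distrib atLeast0LessThan)
  then show ?thesis
    by (simp add: det_def'[of _ d] sum_distrib_left mult_ac)
qed

lemma det_scale_cols:
  "det (mat d d (\<lambda>(i, j). c j * f i j)) = (\<Prod>i<d. c i :: real) * det (mat d d (\<lambda>(i, j). f i j))"
proof -
  have "signof p * (\<Prod>i = 0..<d. mat d d (\<lambda>(i, j). c j * f i j) $$ (i, p i))
      = (\<Prod>i<d. c i) * (signof p * (\<Prod>i = 0..<d. mat d d (\<lambda>(i, j). f i j) $$ (i, p i)))"
    if p: "p permutes {0..<d}" for p
  proof -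
    have "(\<Prod>i<d. c i) = (\<Prod>i = 0..<d. c (p i))"
      using prod.permute[OF p, of c] by (simp add: atLeast0LessThan)
    then show ?thesis
      using permutes_in_image[OF p] by (simp add: prod.distrib)
  qed
  then show ?thesis
    by (simp add: det_def'[of _ d] sum_distrib_left mult_ac)
qed

section \<open>The Dixon--Anderson integral as a determinant\<close>

definition weight :: "(nat \<Rightarrow> real) \<Rightarrow> (nat \<Rightarrow> nat) \<Rightarrow> nat \<Rightarrow> real poly" where
  "weight x a d = (\<Prod>k\<le>d. [:- x k, 1:] ^ a k)"

text \<open>By the Vandermonde expansion this is the integral of the product of all y_j - y_i (i <
  j) and all (y_i - x_k)^(a_k), with each y_i running from x_i to x_(i+1).\<close>

definition dixon_anderson_det :: "(nat \<Rightarrow> real) \<Rightarrow> (nat \<Rightarrow> nat) \<Rightarrow> nat \<Rightarrow> real" where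
  "dixon_anderson_det x a d = det (mat d d (\<lambda>(i, j). pint (x i) (x (Suc i)) (monom 1 j * weight x a d)))"

text \<open>Without weight each entry is a difference of an antiderivative at consecutive points, so
  the matrix arises from the Vandermonde matrix of the x by subtracting consecutive rows;
  \<open>fact d\<close> collects the factors j + 1 from differentiating (y - x_0)^(j + 1).\<close>

lemma dixon_anderson_det_zero: "dixon_anderson_det x (\<lambda>_. 0) d * fact d = (\<Prod>j<Suc d. \<Prod>i<j. x j - x i)"
proof -
  define R where "R i p = (if i = 0 then poly p (x 0) else poly p (x i) - poly p (x (i - 1)))" for i p
  \<comment> \<open>Centred at \<open>x 0\<close>, so that the row of evaluations at
    \<open>x 0\<close> becomes (1, 0, ..., 0) and can be split off.\<close>
  define B where "B j = [:- x 0, 1:] ^ j" for j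
  define V where "V = mat (Suc d) (Suc d) (\<lambda>(i, j). x i ^ j)"
  \<comment> \<open>Left multiplication by \<open>T\<close> keeps the first row and subtracts from
    every other row the one above it.\<close>
  define T where "T = mat (Suc d) (Suc d) (\<lambda>(i, k). if k = i then 1 else if Suc k = i then -1 else 0 :: real)"
  have linR: "linpoly (R i)" for i
    by (cases "i = 0") (simp_all add: R_def[abs_def] linpoly_poly linpoly_diff)
  have deg: "degree (B j) = j" for j
    by (simp add: B_def degree_power_eq)
  have lead: "coeff (B j) j = 1" for j
    using lead_coeff_power[of "[:- x 0, 1:]" j] by (simp add: deg[unfolded B_def] B_def)
  have "mat (Suc d) (Suc d) (\<lambda>(i, j). R i (monom 1 j)) = T * V"
  proof (rule eq_matI)
    fix i j assume "i < dim_row (T * V)" "j < dim_col (T * V)"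
    then have ij: "i < Suc d" "j < Suc d" by (auto simp: T_def V_def)
    have "(T * V) $$ (i, j) = (\<Sum>k = 0..<Suc d. (if k = i then 1 else if Suc k = i then -1 else 0) * x k ^ j)"
      using ij by (simp add: T_def V_def scalar_prod_def)
    also have "\<dots> = (\<Sum>k = 0..<Suc d. (if k = i then x i ^ j else 0) - (if Suc k = i then x k ^ j else 0))"
      by (rule sum.cong) auto
    also have "\<dots> = x i ^ j - (\<Sum>k = 0..<Suc d. if Suc k = i then x k ^ j else 0)"
      using ij by (simp add: sum_subtractf)
    also have "\<dots> = R i (monom 1 j)"
    proof (cases i)
      case (Suc i')
      then show ?thesis using ij by (simp add: R_def poly_monom)
    qed (simp add: R_def poly_monom)
    finally show "mat (Suc d) (Suc d) (\<lambda>(i, j). R i (monom 1 j)) $$ (i, j) = (T * V) $$ (i, j)"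
      using ij by simp
  qed (auto simp: T_def V_def)
  moreover have "det (T * V) = det T * det V"
    by (rule det_mult[of _ "Suc d"]) (auto simp: T_def V_def)
  moreover have "det T = prod_list (diag_mat T)"
    by (rule det_lower_triangular[of "Suc d"]) (auto simp: T_def)
  moreover have "prod_list (diag_mat T) = 1"
    unfolding prod_list_diag_prod by (rule prod.neutral) (auto simp: T_def)
  ultimately have "(\<Prod>j<Suc d. \<Prod>i<j. x j - x i) = det (mat (Suc d) (Suc d) (\<lambda>(i, j). R i (monom 1 j)))"
    by (simp add: V_def vandermonde del: prod.lessThan_Suc)
  also have "\<dots> = det (mat (Suc d) (Suc d) (\<lambda>(i, j). R i (B j)))"
    by (rule det_monic_basis[symmetric]) (auto simp: linR deg lead)
  also have "\<dots> = det (mat d d (\<lambda>(i, j). R (Suc i) (B (Suc j))))"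
    by (subst det_first_row[of _ d]) (auto simp: R_def B_def left_diff_distrib intro!: arg_cong[where f = det] eq_matI)
  also have "\<dots> = det (mat d d (\<lambda>(i, j). real (Suc j) * pint (x i) (x (Suc i)) (B j)))"
  proof -
    have "pderiv (B (Suc j)) = smult (real (Suc j)) (B j)" for j
      by (simp add: B_def pderiv_power_Suc pderiv_pCons del: power_Suc of_nat_Suc)
    then have "R (Suc i) (B (Suc j)) = real (Suc j) * pint (x i) (x (Suc i)) (B j)" for i j
      using pint_pderiv[of "x i" "x (Suc i)" "B (Suc j)"]
      by (simp add: R_def linpoly_smult[OF linpoly_pint] del: of_nat_Suc)
    then show ?thesis by simp
  qed
  also have "\<dots> = (\<Prod>j<d. real (Suc j)) * det (mat d d (\<lambda>(i, j). pint (x i) (x (Suc i)) (B j)))"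
    by (rule det_scale_cols)
  also have "det (mat d d (\<lambda>(i, j). pint (x i) (x (Suc i)) (B j))) = dixon_anderson_det x (\<lambda>_. 0) d"
    unfolding dixon_anderson_det_def by (subst det_monic_basis) (auto simp: linpoly_pint deg lead weight_def)
  also have "(\<Prod>j<d. real (Suc j)) = fact d"
    by (induction d) auto
  finally show ?thesis by simp
qed

text \<open>Border the matrix by the evaluation at x k and compare two monic bases of the polynomials of
  degree at most d. The powers of y - x k give the matrix for the raised exponent; the basis ending
  in S / s, where S w is the derivative of the product of the (y - x l)^(a l + 1), gives the old
  matrix, since every integral of S w vanishes.\<close>
lemma dixon_anderson_det_Suc:
  assumes k: "k \<le> d"
  shows "dixon_anderson_det x (a(k := Suc (a k))) d * real ((\<Sum>l\<le>d. a l) + d + 1)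
    = (-1) ^ d * real (Suc (a k)) * (\<Prod>l\<in>{..d} - {k}. x k - x l) * dixon_anderson_det x a d"
proof -
  \<comment> \<open>The sum of a_l + 1 over the d + 1 points, which is the leading coefficient of
    \<open>S\<close>; hence S / s is monic of degree d.\<close>
  define s where "s = real ((\<Sum>l\<le>d. a l) + d + 1)"
  define w where "w = weight x a d"
  define u where "u l = [:- x l, 1:]" for l
  define S where "S = (\<Sum>l\<le>d. smult (real (Suc (a l))) (\<Prod>m\<in>{..d} - {l}. u m))"
  define L where "L i p = pint (x i) (x (Suc i)) (p * w)" for i p
  define R where "R i p = (if i = 0 then poly p (x k) else L (i - 1) p)" for i p
  define B where "B j = (if j < d then monom 1 j else smult (1 / s) S)" for j
  have s: "s > 0" unfolding s_def of_nat_0_less_iff by simp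
  have linL: "linpoly (L i)" for i
    unfolding L_def[abs_def] by (intro linpoly_mult_right linpoly_pint)
  have linR: "linpoly (R i)" for i
    by (cases "i = 0") (simp_all add: R_def[abs_def] linpoly_poly linL)
  have degu: "degree (u k ^ j) = j" for j
    by (simp add: u_def degree_power_eq)
  have leadu: "coeff (u k ^ j) j = 1" for j
    using lead_coeff_power[of "u k" j] degu[of j] by (simp add: u_def)
  have "pderiv (\<Prod>l\<le>d. u l ^ Suc (a l)) = S * w"
  proof -
    have "(\<Prod>m\<in>{..d} - {l}. u m ^ Suc (a m)) * pderiv (u l ^ Suc (a l))
      = smult (real (Suc (a l))) (\<Prod>m\<in>{..d} - {l}. u m) * w" if "l \<le> d" for l
    proof -
      have "w = u l ^ a l * (\<Prod>m\<in>{..d} - {l}. u m ^ a m)"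
        unfolding w_def weight_def u_def[symmetric] using that by (intro prod.remove) auto
      moreover have "pderiv (u l ^ Suc (a l)) = smult (real (Suc (a l))) (u l ^ a l)"
        by (simp add: u_def pderiv_power_Suc pderiv_pCons del: power_Suc of_nat_Suc)
      ultimately show ?thesis by (simp add: prod.distrib mult_ac del: of_nat_Suc)
    qed
    then show ?thesis
      unfolding pderiv_prod S_def sum_distrib_right by (intro sum.cong) auto
  qed
  then have "L i S = poly (\<Prod>l\<le>d. u l ^ Suc (a l)) (x (Suc i)) - poly (\<Prod>l\<le>d. u l ^ Suc (a l)) (x i)" for i
    unfolding L_def by (metis pint_pderiv)
  moreover have "poly (\<Prod>l\<le>d. u l ^ Suc (a l)) (x i) = 0" if "i \<le> d" for i
    using that by (auto simp: poly_prod u_def)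
  ultimately have LS: "L i S = 0" if "i < d" for i
    using that by simp
  have cd: "card ({..d} - {l}) = d" if "l \<le> d" for l
    using that by simp
  have "degree (smult (real (Suc (a l))) (\<Prod>m\<in>{..d} - {l}. u m)) \<le> d" if "l \<le> d" for l
    using degree_prod_linear[of "{..d} - {l}" x] cd[OF that] by (auto simp: u_def intro: order_trans[OF degree_smult_le])
  then have degS: "degree S \<le> d"
    unfolding S_def by (intro degree_sum_le) auto
  have "coeff S d = (\<Sum>l\<le>d. real (Suc (a l)) * coeff (\<Prod>m\<in>{..d} - {l}. u m) d)"
    by (simp add: S_def coeff_sum)
  also have "\<dots> = (\<Sum>l\<le>d. real (Suc (a l)))"
  proof (rule sum.cong[OF refl])
    fix l assume "l \<in> {..d}"
    then show "real (Suc (a l)) * coeff (\<Prod>m\<in>{..d} - {l}. u m) d = real (Suc (a l))"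
      using coeff_prod_linear[of "{..d} - {l}" x] cd[of l] by (simp add: u_def)
  qed
  also have "\<dots> = s"
    by (simp add: s_def sum.distrib)
  finally have leadS: "coeff S d = s" .
  have "poly S (x k) = (\<Sum>l\<le>d. if l = k then real (Suc (a k)) * (\<Prod>m\<in>{..d} - {k}. x k - x m) else 0)"
    unfolding S_def poly_sum
  proof (rule sum.cong[OF refl])
    fix l assume "l \<in> {..d}"
    then show "poly (smult (real (Suc (a l))) (\<Prod>m\<in>{..d} - {l}. u m)) (x k)
      = (if l = k then real (Suc (a k)) * (\<Prod>m\<in>{..d} - {k}. x k - x m) else 0)"
      using k by (auto simp: poly_prod u_def prod_zero_iff)
  qed
  then have Sk: "poly S (x k) = real (Suc (a k)) * (\<Prod>m\<in>{..d} - {k}. x k - x m)"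
    using k by simp
  have "dixon_anderson_det x (a(k := Suc (a k))) d = det (mat d d (\<lambda>(i, j). L i (monom 1 j * u k)))"
  proof -
    have "weight x (a(k := Suc (a k))) d = u k * w"
    proof -
      have "weight x (a(k := Suc (a k))) d = u k ^ Suc (a k) * (\<Prod>m\<in>{..d} - {k}. u m ^ a m)"
        unfolding weight_def u_def[symmetric] using k by (subst prod.remove[of _ k]) auto
      moreover have "w = u k ^ a k * (\<Prod>m\<in>{..d} - {k}. u m ^ a m)"
        unfolding w_def weight_def u_def[symmetric] using k by (intro prod.remove) auto
      ultimately show ?thesis by (simp add: mult_ac)
    qed
    then show ?thesis by (simp add: dixon_anderson_det_def L_def mult_ac)
  qed
  also have "\<dots> = det (mat d d (\<lambda>(i, j). L i (u k ^ j * u k)))"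
    by (rule det_monic_basis[symmetric]) (auto simp: linpoly_mult_right linL degu leadu)
  \<comment> \<open>All powers of \<open>u k\<close> except the zeroth vanish at \<open>x k\<close>,
    so the border does not change the determinant, and the shift of columns supplies the extra
    factor \<open>u k\<close> in the other rows.\<close>
  also have "\<dots> = det (mat (Suc d) (Suc d) (\<lambda>(i, j). R i (u k ^ j)))"
    by (subst det_first_row[of _ d]) (auto simp: R_def u_def mult_ac intro!: arg_cong[where f = det] eq_matI)
  also have "\<dots> = det (mat (Suc d) (Suc d) (\<lambda>(i, j). R i (monom 1 j)))"
    by (rule det_monic_basis) (auto simp: linR degu leadu)
  also have "\<dots> = det (mat (Suc d) (Suc d) (\<lambda>(i, j). R i (B j)))"
    using s degS leadS by (intro det_monic_basis[symmetric])
      (auto simp: linR B_def degree_monom_eq less_Suc_eq intro: order_trans[OF degree_smult_le])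
  \<comment> \<open>In this basis the last column vanishes below the border row; the sign belongs to
    the top right corner.\<close>
  also have "\<dots> = (-1) ^ d * (poly S (x k) / s) * det (mat d d (\<lambda>(i, j). L i (monom 1 j)))"
    by (subst det_last_col[of _ d])
      (auto simp: R_def B_def LS linpoly_smult[OF linL] intro!: arg_cong[where f = det] eq_matI)
  also have "det (mat d d (\<lambda>(i, j). L i (monom 1 j))) = dixon_anderson_det x a d"
    by (simp add: dixon_anderson_det_def L_def w_def)
  finally have dixon_anderson_det': "dixon_anderson_det x (a(k := Suc (a k))) d = (-1) ^ d * (poly S (x k) / s) * dixon_anderson_det x a d" .
  show ?thesis
    unfolding s_def[symmetric] dixon_anderson_det' Sk using s by (simp del: of_nat_Suc)
qed

text \<open>Raising a_k adds one factor to each pair containing k. For the d - k indices l above k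
  that factor is x_l - x_k, opposite to the x_k - x_l of the product over l; hence the sign.\<close>

lemma prod_pairs_fun_upd_Suc:
  fixes x :: "nat \<Rightarrow> real" and a :: "nat \<Rightarrow> nat"
  assumes k: "k \<le> d"
  defines "a' \<equiv> a(k := Suc (a k))"
  shows "(\<Prod>j<Suc d. \<Prod>i<j. (x j - x i) ^ (a' i + a' j + 1))
    = (\<Prod>j<Suc d. \<Prod>i<j. (x j - x i) ^ (a i + a j + 1)) * ((-1) ^ (d - k) * (\<Prod>l\<in>{..d} - {k}. x k - x l))"
proof -
  have split: "{..d} - {k} = {..<k} \<union> {k<..d}" using k by auto
  have "(\<Prod>l\<in>{k<..d}. x k - x l) = (\<Prod>l\<in>{k<..d}. (-1) * (x l - x k))"
    by (rule prod.cong) auto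
  also have "\<dots> = (-1) ^ (d - k) * (\<Prod>l\<in>{k<..d}. x l - x k)"
    by (subst prod.distrib) simp
  finally have right: "(\<Prod>l\<in>{k<..d}. x k - x l) = (-1) ^ (d - k) * (\<Prod>l\<in>{k<..d}. x l - x k)" .
  have "(-1 :: real) ^ (d - k) * (-1) ^ (d - k) = 1"
    by (simp flip: power_mult_distrib)
  moreover have "(\<Prod>l\<in>{..d} - {k}. x k - x l) = (\<Prod>l<k. x k - x l) * (\<Prod>l\<in>{k<..d}. x k - x l)"
    unfolding split by (rule prod.union_disjoint) auto
  ultimately have signed: "(-1) ^ (d - k) * (\<Prod>l\<in>{..d} - {k}. x k - x l) = (\<Prod>l<k. x k - x l) * (\<Prod>l\<in>{k<..d}. x l - x k)"
    unfolding right by (metis (no_types, lifting) mult.assoc mult.left_commute mult_1)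
  have inner: "(\<Prod>i<j. (x j - x i) ^ (a' i + a' j + 1)) = (\<Prod>i<j. (x j - x i) ^ (a i + a j + 1)) *
      ((if j = k then (\<Prod>l<k. x k - x l) else 1) * (if k < j then x j - x k else 1))" for j
  proof -
    have "(\<Prod>i<j. (x j - x i) ^ (a' i + a' j + 1)) =
      (\<Prod>i<j. (x j - x i) ^ (a i + a j + 1) * ((if j = k then x k - x i else 1) * (if i = k then x j - x k else 1)))"
      by (rule prod.cong) (auto simp: a'_def)
    also have "\<dots> = (\<Prod>i<j. (x j - x i) ^ (a i + a j + 1)) *
      ((\<Prod>i<j. if j = k then x k - x i else 1) * (\<Prod>i<j. if i = k then x j - x k else 1))"
      by (simp add: prod.distrib)
    also have "(\<Prod>i<j. if j = k then x k - x i else 1) = (if j = k then (\<Prod>l<k. x k - x l) else 1)"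
      by simp
    also have "(\<Prod>i<j. if i = k then x j - x k else 1) = (if k < j then x j - x k else 1)"
      by simp
    finally show ?thesis .
  qed
  have "(\<Prod>j<Suc d. if j = k then (\<Prod>l<k. x k - x l) else 1) = (\<Prod>l<k. x k - x l)"
    using k by (simp del: prod.lessThan_Suc)
  moreover have "(\<Prod>j<Suc d. if k < j then x j - x k else 1) = (\<Prod>l\<in>{k<..d}. x l - x k)"
  proof -
    have "(\<Prod>j<Suc d. if k < j then x j - x k else 1) = (\<Prod>j | j \<in> {..<Suc d} \<and> k < j. x j - x k)"
      by (rule prod.inter_filter[symmetric]) simp
    also have "{j. j \<in> {..<Suc d} \<and> k < j} = {k<..d}" by auto
    finally show ?thesis .
  qed
  ultimately show ?thesis
    unfolding inner signed by (simp add: prod.distrib del: prod.lessThan_Suc)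
qed

text \<open>Induction on the total exponent, raising one exponent at a time. Of the sign (-1)^d in
  \<open>dixon_anderson_det_Suc\<close> the pair factors absorb (-1)^(d - k), so each unit of a_k
  leaves (-1)^k.\<close>

lemma dixon_anderson:
  "dixon_anderson_det x a d * fact ((\<Sum>k\<le>d. a k) + d)
    = (\<Prod>k\<le>d. fact (a k)) * (\<Prod>k\<le>d. (-1) ^ (k * a k)) * (\<Prod>j<Suc d. \<Prod>i<j. (x j - x i) ^ (a i + a j + 1))"
proof (induction "\<Sum>k\<le>d. a k" arbitrary: a)
  case 0
  then have a0: "a k = 0" if "k \<le> d" for k using that by auto
  have "dixon_anderson_det x a d = dixon_anderson_det x (\<lambda>_. 0) d"
    unfolding dixon_anderson_det_def weight_def by (simp add: a0)
  moreover have "(\<Prod>j<Suc d. \<Prod>i<j. (x j - x i) ^ (a i + a j + 1)) = (\<Prod>j<Suc d. \<Prod>i<j. x j - x i)"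
    by (intro prod.cong refl) (auto simp: a0)
  ultimately show ?case
    using dixon_anderson_det_zero[of x d] by (simp add: a0 del: prod.lessThan_Suc)
next
  case (Suc s)
  have "\<exists>k\<le>d. a k > 0"
  proof (rule ccontr)
    assume "\<not> ?thesis"
    then have "(\<Sum>k\<le>d. a k) = 0" by simp
    then show False using Suc.hyps(2) by simp
  qed
  then obtain k where k: "k \<le> d" "a k > 0" by blast
  define b where "b = a(k := a k - 1)"
  have ab: "a = b(k := Suc (b k))" using k by (auto simp: b_def)
  have "(\<Sum>l\<le>d. a l) = Suc (\<Sum>l\<le>d. b l)"
    using k by (simp add: ab sum.remove[of "{..d}" k])
  then have sb: "s = (\<Sum>l\<le>d. b l)" "(\<Sum>l\<le>d. a l) = Suc s" using Suc.hyps(2) by auto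
  have facts: "(\<Prod>l\<le>d. fact (a l)) = real (Suc (b k)) * (\<Prod>l\<le>d. fact (b l))"
    using k by (simp add: ab prod.remove[of "{..d}" k])
  have signs: "(\<Prod>l\<le>d. (-1) ^ (l * a l)) = (-1) ^ k * (\<Prod>l\<le>d. (-1) ^ (l * b l) :: real)"
    using k by (simp add: ab prod.remove[of "{..d}" k] power_add)
  have IH: "dixon_anderson_det x b d * fact (s + d)
    = (\<Prod>k\<le>d. fact (b k)) * (\<Prod>k\<le>d. (-1) ^ (k * b k)) * (\<Prod>j<Suc d. \<Prod>i<j. (x j - x i) ^ (b i + b j + 1))"
    using Suc.hyps(1)[OF sb(1)] sb(1) by simp
  define Q where "Q = (\<Prod>l\<in>{..d} - {k}. x k - x l)"
  have "dixon_anderson_det x a d * fact ((\<Sum>k\<le>d. a k) + d) = (dixon_anderson_det x a d * real ((\<Sum>l\<le>d. b l) + d + 1)) * fact (s + d)"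
    unfolding sb(2) unfolding sb(1)[symmetric] by (simp add: mult_ac)
  also have "dixon_anderson_det x a d * real ((\<Sum>l\<le>d. b l) + d + 1) = (-1) ^ d * real (Suc (b k)) * Q * dixon_anderson_det x b d"
    using dixon_anderson_det_Suc[OF k(1), of x b] unfolding ab[symmetric] Q_def .
  also have "(-1) ^ d * real (Suc (b k)) * Q * dixon_anderson_det x b d * fact (s + d) = (-1) ^ d * real (Suc (b k)) * Q * (dixon_anderson_det x b d * fact (s + d))"
    by (simp only: mult.assoc)
  also have "\<dots> = (-1) ^ d * real (Suc (b k)) * Q * ((\<Prod>k\<le>d. fact (b k)) * (\<Prod>k\<le>d. (-1) ^ (k * b k)) * (\<Prod>j<Suc d. \<Prod>i<j. (x j - x i) ^ (b i + b j + 1)))"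
    unfolding IH ..
  also have "(-1) ^ d = (-1 :: real) ^ k * (-1) ^ (d - k)"
    using k by (simp flip: power_add)
  also have "(-1) ^ k * (-1) ^ (d - k) * real (Suc (b k)) * Q * ((\<Prod>k\<le>d. fact (b k)) * (\<Prod>k\<le>d. (-1) ^ (k * b k)) * (\<Prod>j<Suc d. \<Prod>i<j. (x j - x i) ^ (b i + b j + 1)))
    = (real (Suc (b k)) * (\<Prod>k\<le>d. fact (b k))) * ((-1) ^ k * (\<Prod>k\<le>d. (-1) ^ (k * b k)))
      * ((\<Prod>j<Suc d. \<Prod>i<j. (x j - x i) ^ (b i + b j + 1)) * ((-1) ^ (d - k) * Q))"
    by (simp only: mult_ac)
  also have "(\<Prod>j<Suc d. \<Prod>i<j. (x j - x i) ^ (b i + b j + 1)) * ((-1) ^ (d - k) * Q) = (\<Prod>j<Suc d. \<Prod>i<j. (x j - x i) ^ (a i + a j + 1))"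
    using prod_pairs_fun_upd_Suc[OF k(1), of x b] unfolding ab[symmetric] Q_def by simp
  finally show ?case
    unfolding facts signs .
qed

section \<open>Orderings and colourings\<close>

lemma card_bijections:
  fixes A :: "'a set" and B :: "'b set"
  assumes "finite A" "finite B" "card A = card B"
  shows "card {g \<in> extensional A. bij_betw g A B} = fact (card A)"
  using assms
proof (induction A arbitrary: B rule: finite_induct)
  case empty
  then have "{g \<in> extensional ({} :: 'a set). bij_betw g {} B} = {\<lambda>_. undefined}"
    by (auto simp: bij_betw_def)
  then show ?case by simp
next
  case (insert a A)
  let ?S = "\<lambda>b. {g \<in> extensional (insert a A). bij_betw g (insert a A) B \<and> g a = b}"
  have "{g \<in> extensional (insert a A). bij_betw g (insert a A) B} = (\<Union>b\<in>B. ?S b)"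
    by (auto simp: bij_betw_def)
  moreover have card_S: "card (?S b) = fact (card A) \<and> finite (?S b)" if b: "b \<in> B" for b
  proof -
    let ?T = "{g \<in> extensional A. bij_betw g A (B - {b})}"
    have bij: "bij_betw (\<lambda>g. g(a := undefined)) (?S b) ?T"
    proof (rule bij_betw_byWitness[where f' = "\<lambda>g. g(a := b)"])
      show "\<forall>g\<in>?S b. (g(a := undefined))(a := b) = g" by auto
      show "\<forall>g\<in>?T. (g(a := b))(a := undefined) = g"
        using insert.hyps by (auto simp: extensional_def fun_eq_iff)
      show "(\<lambda>g. g(a := undefined)) ` ?S b \<subseteq> ?T"
      proof safe
        fix g assume g: "g \<in> extensional (insert a A)" "bij_betw g (insert a A) B" "b = g a"
        show "g(a := undefined) \<in> extensional A" using g(1) by (auto simp: extensional_def)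
        have "bij_betw g A (B - {g a})"
          using g(2) insert.hyps(2) by (simp add: bij_betw_def) blast
        then show "bij_betw (g(a := undefined)) A (B - {g a})"
          using insert.hyps(2) by (subst bij_betw_cong[where g = g]) auto
      qed
      show "(\<lambda>g. g(a := b)) ` ?T \<subseteq> ?S b"
      proof safe
        fix g assume g: "g \<in> extensional A" "bij_betw g A (B - {b})"
        show "g(a := b) \<in> extensional (insert a A)" using g(1) by (auto simp: extensional_def)
        have "bij_betw (g(a := b)) A (B - {b})"
          using insert.hyps(2) g(2) by (subst bij_betw_cong[where g = g]) auto
        then have "bij_betw (g(a := b)) (insert a A) (insert b (B - {b}))"
          using insert.hyps(2) notIn_Un_bij_betw[of a A "g(a := b)" "B - {b}"] by simp
        then show "bij_betw (g(a := b)) (insert a A) B"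
          using b by (simp add: insert_absorb)
      qed simp
    qed
    have "card (B - {b}) = card A"
      using insert.prems insert.hyps b by simp
    then have cT: "card ?T = fact (card A)"
      using insert.IH[of "B - {b}"] insert.prems by simp
    then have "finite ?T"
      by (metis card.infinite fact_nonzero)
    then show ?thesis
      unfolding bij_betw_same_card[OF bij] bij_betw_finite[OF bij] cT by simp
  qed
  ultimately have "card {g \<in> extensional (insert a A). bij_betw g (insert a A) B} = (\<Sum>b\<in>B. card (?S b))"
    using insert.prems(1) by (subst card_UN_disjoint[symmetric]) auto
  also have "\<dots> = card B * fact (card A)"
    using card_S by simp
  finally show ?case
    using insert.hyps by (simp add: insert.prems(2)[symmetric])
qed

section \<open>The vertices W and the gaps that can receive them\<close>

definition GX_W :: "nat \<Rightarrow> (nat \<Rightarrow> nat) \<Rightarrow> gx_vertex set" where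
  "GX_W m \<alpha> = {W i j k | i j k. 1 \<le> i \<and> i < j \<and> j \<le> m \<and> k \<in> {1..\<alpha> i * \<alpha> j}}"

fun gaps :: "gx_vertex \<Rightarrow> nat set" where
  "gaps (W i j k) = {i..<j}"
| "gaps (U i) = {}"

text \<open>A topological ordering puts each W i j k into exactly one of the gaps between consecutive
  vertices U l and U (l + 1) with l in {i..<j}; a colouring records that choice.\<close>
definition colourings :: "nat \<Rightarrow> (nat \<Rightarrow> nat) \<Rightarrow> (gx_vertex \<Rightarrow> nat) set" where
  "colourings m \<alpha> = (\<Pi>\<^sub>E w \<in> GX_W m \<alpha>. gaps w)"

definition gap_class :: "nat \<Rightarrow> (nat \<Rightarrow> nat) \<Rightarrow> (gx_vertex \<Rightarrow> nat) \<Rightarrow> nat \<Rightarrow> gx_vertex set" where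
  "gap_class m \<alpha> c l = {w \<in> GX_W m \<alpha>. c w = l}"

text \<open>The label forced on U i once every W has its gap: the vertices up to U i are U 1, ..., U
  i and the W in gaps before i.\<close>

definition position :: "nat \<Rightarrow> (nat \<Rightarrow> nat) \<Rightarrow> (gx_vertex \<Rightarrow> nat) \<Rightarrow> nat \<Rightarrow> nat" where
  "position m \<alpha> c i = i + (\<Sum>l = 1..<i. card (gap_class m \<alpha> c l))"

lemma GX_W_eq_image: "GX_W m \<alpha> = (\<lambda>((i, j), k). W i j k) ` (SIGMA (i, j):{(i, j). 1 \<le> i \<and> i < j \<and> j \<le> m}. {1..\<alpha> i * \<alpha> j})"
  by (force simp: GX_W_def)

lemma finite_pairs: "finite {(i, j :: nat). 1 \<le> i \<and> i < j \<and> j \<le> m}"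
  by (rule finite_subset[of _ "{..m} \<times> {..m}"]) auto

lemma finite_GX_W: "finite (GX_W m \<alpha>)"
  unfolding GX_W_eq_image using finite_pairs[of m] by (intro finite_imageI finite_SigmaI) auto

lemma card_GX_W: "card (GX_W m \<alpha>) = (\<Sum>(i, j) | 1 \<le> i \<and> i < j \<and> j \<le> m. \<alpha> i * \<alpha> j)"
proof -
  have "card (GX_W m \<alpha>) = card (SIGMA (i, j):{(i, j). 1 \<le> i \<and> i < j \<and> j \<le> m}. {1..\<alpha> i * \<alpha> j})"
    unfolding GX_W_eq_image by (rule card_image) (auto simp: inj_on_def)
  then show ?thesis
    using finite_pairs[of m] by (simp add: card_SigmaI case_prod_unfold)
qed

lemma pverts_GX: "pverts (GX m \<alpha>) = U ` {1..m} \<union> GX_W m \<alpha>"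
  by (auto simp: GX_def GX_W_def)

lemma U_notin_GX_W [simp]: "U i \<notin> GX_W m \<alpha>"
  by (simp add: GX_W_def)

lemma finite_pverts_GX: "finite (pverts (GX m \<alpha>))"
  by (simp add: pverts_GX finite_GX_W)

lemma card_pverts_GX_W: "card (pverts (GX m \<alpha>)) = m + card (GX_W m \<alpha>)"
proof -
  have "card (pverts (GX m \<alpha>)) = card (U ` {1..m}) + card (GX_W m \<alpha>)"
    unfolding pverts_GX by (rule card_Un_disjoint) (auto simp: finite_GX_W)
  also have "card (U ` {1..m}) = m"
    by (simp add: card_image inj_on_def)
  finally show ?thesis .
qed

lemma card_pverts_GX: "card (pverts (GX m \<alpha>)) = m + (\<Sum>(i, j) | 1 \<le> i \<and> i < j \<and> j \<le> m. \<alpha> i * \<alpha> j)"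
  by (simp add: card_pverts_GX_W card_GX_W)

lemma finite_gap_class: "finite (gap_class m \<alpha> c l)"
  by (simp add: gap_class_def finite_GX_W)

lemma finite_colourings: "finite (colourings m \<alpha>)"
  unfolding colourings_def
proof (rule finite_PiE[OF finite_GX_W])
  show "finite (gaps w)" for w by (cases w) auto
qed

lemma colouring_range:
  assumes "c \<in> colourings m \<alpha>" "w \<in> GX_W m \<alpha>"
  shows "c w \<in> {1..<m}"
  using assms by (fastforce simp: colourings_def GX_W_def PiE_iff)

lemma position_Suc: "1 \<le> i \<Longrightarrow> position m \<alpha> c (Suc i) = Suc (position m \<alpha> c i) + card (gap_class m \<alpha> c i)"
  by (simp add: position_def)

lemma position_mono: "i \<le> j \<Longrightarrow> position m \<alpha> c i \<le> position m \<alpha> c j"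
  unfolding position_def by (intro add_mono sum_mono2) auto

lemma position_strict_mono: "i < j \<Longrightarrow> position m \<alpha> c i < position m \<alpha> c j"
  unfolding position_def by (intro add_less_le_mono sum_mono2) auto

lemma sum_card_gap_class:
  "(\<Sum>l\<in>L. card (gap_class m \<alpha> c l)) = card {w \<in> GX_W m \<alpha>. c w \<in> L}" if "finite L"
proof -
  have "{w \<in> GX_W m \<alpha>. c w \<in> L} = (\<Union>l\<in>L. gap_class m \<alpha> c l)"
    by (auto simp: gap_class_def)
  then show ?thesis
    using that by (subst card_UN_disjoint[symmetric]) (auto simp: finite_gap_class gap_class_def finite_GX_W)
qed

lemma position_last:
  assumes "c \<in> colourings m \<alpha>"
  shows "position m \<alpha> c m = card (pverts (GX m \<alpha>))"
proof -
  have "{w \<in> GX_W m \<alpha>. c w \<in> {1..<m}} = GX_W m \<alpha>"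
    using colouring_range[OF assms] by blast
  then show ?thesis
    by (simp add: position_def sum_card_gap_class card_pverts_GX_W)
qed

section \<open>Topological orderings with a given colouring\<close>

text \<open>No edge joins two W, so the colouring leaves the arrangement inside each gap free: the
  labels of the U are forced, and the W of a gap may take the labels strictly between in any
  order.\<close>

definition fibre :: "nat \<Rightarrow> (nat \<Rightarrow> nat) \<Rightarrow> (gx_vertex \<Rightarrow> nat) \<Rightarrow> (gx_vertex \<Rightarrow> nat) set" where
  "fibre m \<alpha> c = {f \<in> extensional (pverts (GX m \<alpha>)).
     (\<forall>i\<in>{1..m}. f (U i) = position m \<alpha> c i) \<and>
     (\<forall>l\<in>{1..<m}. bij_betw f (gap_class m \<alpha> c l) {position m \<alpha> c l<..<position m \<alpha> c (Suc l)})}"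

lemma fibre_bounds:
  assumes c: "c \<in> colourings m \<alpha>" and f: "f \<in> fibre m \<alpha> c" and w: "w \<in> GX_W m \<alpha>"
  shows "position m \<alpha> c (c w) < f w" "f w < position m \<alpha> c (Suc (c w))"
proof -
  have "bij_betw f (gap_class m \<alpha> c (c w)) {position m \<alpha> c (c w)<..<position m \<alpha> c (Suc (c w))}"
    using f colouring_range[OF c w] by (auto simp: fibre_def)
  moreover have "w \<in> gap_class m \<alpha> c (c w)"
    using w by (simp add: gap_class_def)
  ultimately have "f w \<in> {position m \<alpha> c (c w)<..<position m \<alpha> c (Suc (c w))}"
    by (rule bij_betwE[rule_format])
  then show "position m \<alpha> c (c w) < f w" "f w < position m \<alpha> c (Suc (c w))" by auto
qed

text \<open>A discrete intermediate value principle: take the first step at which g passes y. It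
  locates a label, or a vertex W, among the labels of the U.\<close>

lemma gap_exists:
  fixes g :: "nat \<Rightarrow> nat"
  assumes "g i \<le> y" "y < g j" "i < j"
  shows "\<exists>l\<in>{i..<j}. g l \<le> y \<and> y < g (Suc l)"
proof -
  define l where "l = (LEAST l. i \<le> l \<and> y < g (Suc l))"
  have *: "i \<le> j - 1 \<and> y < g (Suc (j - 1))" using assms by auto
  have l: "i \<le> l \<and> y < g (Suc l)" unfolding l_def by (rule LeastI[of _ "j - 1"]) (rule *)
  have "l \<le> j - 1" unfolding l_def by (rule Least_le) (rule *)
  moreover have "g l \<le> y"
  proof (cases "l = i")
    case False
    then have "l - 1 < l" "i \<le> l - 1" "Suc (l - 1) = l" using l by auto
    then show ?thesis
      using not_less_Least[of "l - 1" "\<lambda>l. i \<le> l \<and> y < g (Suc l)"] l_def by fastforce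
  qed (use assms in simp)
  ultimately show ?thesis using l assms by (intro bexI[of _ l]) auto
qed

lemma fibre_subset_Topo:
  assumes m: "1 \<le> m" and c: "c \<in> colourings m \<alpha>"
  shows "fibre m \<alpha> c \<subseteq> Topo (GX m \<alpha>)"
proof
  fix f assume f: "f \<in> fibre m \<alpha> c"
  let ?V = "pverts (GX m \<alpha>)" and ?q = "position m \<alpha> c"
  have fU: "f (U i) = ?q i" if "1 \<le> i" "i \<le> m" for i
    using f that by (auto simp: fibre_def)
  \<comment> \<open>Surjectivity suffices, there being as many labels as vertices. A label is either
    the position of some U or lies strictly inside one gap.\<close>
  have "{1..card ?V} \<subseteq> f ` ?V"
  proof
    fix y assume "y \<in> {1..card ?V}"
    then have y: "1 \<le> y" "y \<le> ?q m" by (auto simp: position_last[OF c])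
    show "y \<in> f ` ?V"
    proof (cases "y = ?q m")
      case True
      then show ?thesis using fU[of m] m by (auto simp: pverts_GX intro!: image_eqI[of _ _ "U m"])
    next
      case False
      have "?q 1 = 1" by (simp add: position_def)
      then have "1 < m" using y False by (metis le_antisym m nat_less_le)
      then obtain l where l: "l \<in> {1..<m}" "?q l \<le> y" "y < ?q (Suc l)"
        using gap_exists[of ?q 1 y m] y False \<open>?q 1 = 1\<close> by auto
      show ?thesis
      proof (cases "y = ?q l")
        case True
        then show ?thesis using fU[of l] l by (auto simp: pverts_GX intro!: image_eqI[of _ _ "U l"])
      next
        case False
        then have "y \<in> {?q l<..<?q (Suc l)}" using l by auto
        moreover have "bij_betw f (gap_class m \<alpha> c l) {?q l<..<?q (Suc l)}"
          using f l(1) by (auto simp: fibre_def)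
        ultimately have "y \<in> f ` gap_class m \<alpha> c l" by (simp add: bij_betw_def)
        then show ?thesis by (auto simp: gap_class_def pverts_GX)
      qed
    qed
  qed
  moreover have "card (f ` ?V) \<le> card {1..card ?V}"
    using card_image_le[OF finite_pverts_GX] by simp
  ultimately have "f ` ?V = {1..card ?V}"
    using card_seteq[of "f ` ?V" "{1..card ?V}"] finite_pverts_GX by (metis finite_imageI)
  then have "bij_betw f ?V {1..card ?V}"
    using eq_card_imp_inj_on[OF finite_pverts_GX, of f m \<alpha>] by (simp add: bij_betw_def)
  moreover have "f u > f v" if uv: "(u, v) \<in> parcs (GX m \<alpha>)" for u v
  proof -
    \<comment> \<open>The colour of W i j k lies in {i..<j}, so monotonicity of
      \<open>position\<close> puts its label between those of U i and U j.\<close>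
    consider i where "u = U (i + 1)" "v = U i" "1 \<le> i" "i + 1 \<le> m"
      | i j k where "u = U j" "v = W i j k" "W i j k \<in> GX_W m \<alpha>"
      | i j k where "u = W i j k" "v = U i" "W i j k \<in> GX_W m \<alpha>"
      using uv by (auto simp: GX_def GX_W_def)
    then show ?thesis
    proof cases
      case 1
      then show ?thesis using fU position_strict_mono[of i "i + 1"] by simp
    next
      case 2
      then have "c v \<in> gaps v" using c unfolding colourings_def by (auto intro: PiE_mem simp del: gaps.simps)
      then have "c v \<in> {i..<j}" "1 \<le> j" "j \<le> m" using 2 by (auto simp: GX_W_def)
      then show ?thesis
        using fibre_bounds(2)[OF c f, of v] 2 fU[of j] position_mono[of "Suc (c v)" j m \<alpha> c] by simp
    next
      case 3
      then have "c u \<in> gaps u" using c unfolding colourings_def by (auto intro: PiE_mem simp del: gaps.simps)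
      then have "c u \<in> {i..<j}" "1 \<le> i" "i \<le> m" using 3 by (auto simp: GX_W_def)
      then show ?thesis
        using fibre_bounds(1)[OF c f, of u] 3 fU[of i] position_mono[of i "c u" m \<alpha> c] by simp
    qed
  qed
  moreover have "f \<in> extensional ?V" using f by (simp add: fibre_def)
  ultimately show "f \<in> Topo (GX m \<alpha>)" by (auto simp: Topo_def)
qed

lemma Topo_in_fibre:
  assumes f: "f \<in> Topo (GX m \<alpha>)"
  shows "\<exists>c\<in>colourings m \<alpha>. f \<in> fibre m \<alpha> c"
proof -
  let ?V = "pverts (GX m \<alpha>)"
  have ext: "f \<in> extensional ?V" and bij: "bij_betw f ?V {1..card ?V}"
    and arc: "\<And>u v. (u, v) \<in> parcs (GX m \<alpha>) \<Longrightarrow> f v < f u"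
    using f by (auto simp: Topo_def)
  have inj: "inj_on f ?V" using bij by (simp add: bij_betw_def)
  have U_step: "f (U i) < f (U (Suc i))" if "1 \<le> i" "i < m" for i
    using that by (intro arc) (auto simp: GX_def)
  have U_less: "f (U i) < f (U j)" if "i < j" "1 \<le> i" "j \<le> m" for i j
    using that
  proof (induction j)
    case (Suc j)
    then show ?case using U_step[of j] by (cases "i = j") auto
  qed simp
  have U_le: "f (U i) \<le> f (U j)" if "i \<le> j" "1 \<le> i" "j \<le> m" for i j
    using U_less[of i j] that by (cases "i = j") auto
  define c where "c = (\<lambda>w\<in>GX_W m \<alpha>. SOME l. l \<in> gaps w \<and> f (U l) < f w \<and> f w < f (U (Suc l)))"
  have c: "c w \<in> gaps w \<and> f (U (c w)) < f w \<and> f w < f (U (Suc (c w)))" if w: "w \<in> GX_W m \<alpha>" for w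
  proof -
    obtain i j k where w': "w = W i j k" "1 \<le> i" "i < j" "j \<le> m" "k \<in> {1..\<alpha> i * \<alpha> j}"
      using w by (auto simp: GX_W_def)
    have "f (U i) < f w" "f w < f (U j)"
      using w' by (auto intro!: arc simp: GX_def)
    then obtain l where l: "l \<in> {i..<j}" "f (U l) \<le> f w" "f w < f (U (Suc l))"
      using gap_exists[of "\<lambda>l. f (U l)" i "f w" j] w' by auto
    \<comment> \<open>\<open>gap_exists\<close> gives only a weak lower bound; it is strict because
      \<open>f\<close> is injective and a W is never a U.\<close>
    have "U l \<in> ?V" "w \<in> ?V" "U l \<noteq> w"
      using l w' w by (auto simp: pverts_GX)
    then have "f (U l) \<noteq> f w" using inj by (meson inj_onD)
    then have "\<exists>l. l \<in> gaps w \<and> f (U l) < f w \<and> f w < f (U (Suc l))"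
      using l w' by (intro exI[of _ l]) auto
    then show ?thesis using w by (simp add: c_def) (rule someI_ex)
  qed
  have cC: "c \<in> colourings m \<alpha>"
    using c by (auto simp: colourings_def PiE_iff) (simp add: c_def)
  have less_iff: "f w < f (U i) \<longleftrightarrow> c w < i" if w: "w \<in> GX_W m \<alpha>" and i: "1 \<le> i" "i \<le> m" for w i
  proof
    assume *: "f w < f (U i)"
    show "c w < i"
    proof (rule ccontr)
      assume "\<not> c w < i"
      then have "f (U i) \<le> f (U (c w))" using i colouring_range[OF cC w] by (intro U_le) auto
      then show False using c[OF w] * by linarith
    qed
  next
    assume "c w < i"
    then have "f (U (Suc (c w))) \<le> f (U i)" using i colouring_range[OF cC w] by (intro U_le) auto
    then show "f w < f (U i)" using c[OF w] by linarith
  qed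
  \<comment> \<open>The label of a vertex counts the vertices with labels up to it. By
    \<open>less_iff\<close> those up to U i are exactly the ones counted by
    \<open>position\<close>.\<close>
  have pos: "f (U i) = position m \<alpha> c i" if i: "1 \<le> i" "i \<le> m" for i
  proof -
    have Ui: "U i \<in> ?V" using i by (auto simp: pverts_GX)
    have fUi: "f (U i) \<le> card ?V" using bij_betwE[OF bij] Ui by fastforce
    have "f ` {v \<in> ?V. f v \<le> f (U i)} = {1..f (U i)}"
    proof safe
      fix v assume "v \<in> ?V" "f v \<le> f (U i)"
      then show "f v \<in> {1..f (U i)}" using bij_betwE[OF bij] by auto
    next
      fix y assume y: "y \<in> {1..f (U i)}"
      then have "y \<in> f ` ?V" using bij fUi by (auto simp: bij_betw_def)
      then show "y \<in> f ` {v \<in> ?V. f v \<le> f (U i)}" using y by auto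
    qed
    then have "f (U i) = card {v \<in> ?V. f v \<le> f (U i)}"
      using card_image[OF inj_on_subset[OF inj, of "{v \<in> ?V. f v \<le> f (U i)}"]] by auto
    also have "{v \<in> ?V. f v \<le> f (U i)} = U ` {1..i} \<union> {w \<in> GX_W m \<alpha>. c w \<in> {1..<i}}"
    proof (intro Set.set_eqI iffI)
      fix v assume v: "v \<in> {v \<in> ?V. f v \<le> f (U i)}"
      then consider j where "v = U j" "1 \<le> j" "j \<le> m" | "v \<in> GX_W m \<alpha>" by (auto simp: pverts_GX)
      then show "v \<in> U ` {1..i} \<union> {w \<in> GX_W m \<alpha>. c w \<in> {1..<i}}"
      proof cases
        case 1
        then have "j \<le> i" using U_less[of i j] v i by (metis (no_types, lifting) leD linorder_le_less_linear mem_Collect_eq)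
        then show ?thesis using 1 by auto
      next
        case 2
        then have "v \<noteq> U i" by auto
        then have "f v \<noteq> f (U i)" using inj Ui v by (metis (no_types, lifting) inj_onD mem_Collect_eq)
        then show ?thesis using v less_iff[OF 2 i] colouring_range[OF cC 2] 2 by auto
      qed
    next
      fix v assume v: "v \<in> U ` {1..i} \<union> {w \<in> GX_W m \<alpha>. c w \<in> {1..<i}}"
      then show "v \<in> {v \<in> ?V. f v \<le> f (U i)}"
        using U_le i less_iff by (force simp: pverts_GX intro: less_imp_le)
    qed
    also have "card \<dots> = card (U ` {1..i}) + card {w \<in> GX_W m \<alpha>. c w \<in> {1..<i}}"
      by (rule card_Un_disjoint) (auto simp: finite_GX_W)
    also have "\<dots> = position m \<alpha> c i"
      by (simp add: position_def sum_card_gap_class card_image inj_on_def)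
    finally show ?thesis .
  qed
  have "bij_betw f (gap_class m \<alpha> c l) {position m \<alpha> c l<..<position m \<alpha> c (Suc l)}" if l: "l \<in> {1..<m}" for l
    unfolding bij_betw_def
  proof
    show "inj_on f (gap_class m \<alpha> c l)"
      using inj by (rule inj_on_subset) (auto simp: gap_class_def pverts_GX)
    have q: "position m \<alpha> c l = f (U l)" "position m \<alpha> c (Suc l) = f (U (Suc l))"
      using l by (auto simp: pos)
    show "f ` gap_class m \<alpha> c l = {position m \<alpha> c l<..<position m \<alpha> c (Suc l)}"
    proof safe
      fix w assume "w \<in> gap_class m \<alpha> c l"
      then show "f w \<in> {position m \<alpha> c l<..<position m \<alpha> c (Suc l)}"
        unfolding q using c[of w] by (auto simp: gap_class_def)
    next
      fix y assume y: "y \<in> {position m \<alpha> c l<..<position m \<alpha> c (Suc l)}"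
      have "f (U (Suc l)) \<in> {1..card ?V}" using bij_betwE[OF bij] l by (auto simp: pverts_GX)
      then have "y \<in> {1..card ?V}" using y unfolding q by auto
      then have "y \<in> f ` ?V" using bij by (simp add: bij_betw_def)
      then obtain v where v: "v \<in> ?V" "y = f v" by blast
      show "y \<in> f ` gap_class m \<alpha> c l"
      proof (cases "v \<in> GX_W m \<alpha>")
        case True
        have "c v < Suc l" "\<not> c v < l"
          using less_iff[OF True, of "Suc l"] less_iff[OF True, of l] y v l unfolding q by auto
        then show ?thesis using v True by (auto simp: gap_class_def)
      next
        case False
        then obtain j where j: "v = U j" "1 \<le> j" "j \<le> m" using v by (auto simp: pverts_GX)
        show ?thesis
        proof (cases "j \<le> l")
          case True
          then show ?thesis using U_le[of j l] l j y v unfolding q by auto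
        next
          case False
          then show ?thesis using U_le[of "Suc l" j] l j y v unfolding q by auto
        qed
      qed
    qed
  qed
  then have "f \<in> fibre m \<alpha> c" using ext pos by (auto simp: fibre_def)
  then show ?thesis using cC by blast
qed

text \<open>The labels of the U determine the positions, so two different colours of w would put
  \<open>f w\<close> into two disjoint intervals.\<close>

lemma fibre_disjoint:
  assumes c: "c \<in> colourings m \<alpha>" and c': "c' \<in> colourings m \<alpha>" and f: "f \<in> fibre m \<alpha> c" "f \<in> fibre m \<alpha> c'"
  shows "c = c'"
proof (rule PiE_ext)
  show "c \<in> (\<Pi>\<^sub>E w \<in> GX_W m \<alpha>. gaps w)" "c' \<in> (\<Pi>\<^sub>E w \<in> GX_W m \<alpha>. gaps w)"
    using c c' by (auto simp: colourings_def)
  fix w assume w: "w \<in> GX_W m \<alpha>"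
  have q: "position m \<alpha> c i = position m \<alpha> c' i" if "1 \<le> i" "i \<le> m" for i
  proof -
    have "f (U i) = position m \<alpha> c i" "f (U i) = position m \<alpha> c' i" using f that by (auto simp: fibre_def)
    then show ?thesis by simp
  qed
  have r: "c w \<in> {1..<m}" "c' w \<in> {1..<m}" using colouring_range c c' w by auto
  note b = fibre_bounds[OF c f(1) w] fibre_bounds[OF c' f(2) w]
  have "\<not> c w < c' w"
    using position_mono[of "Suc (c w)" "c' w" m \<alpha> c'] b q[of "Suc (c w)"] r by auto
  moreover have "\<not> c' w < c w"
    using position_mono[of "Suc (c' w)" "c w" m \<alpha> c] b q[of "Suc (c' w)"] r by auto
  ultimately show "c w = c' w" by simp
qed

text \<open>The gaps are filled independently, and by \<open>position_Suc\<close> gap l has as many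
  free labels as vertices. \<open>?\<Phi>\<close> restricts an ordering to the gap classes;
  \<open>?\<Psi>\<close> glues the pieces and puts the forced labels on the U.\<close>

lemma card_fibre:
  assumes c: "c \<in> colourings m \<alpha>"
  shows "card (fibre m \<alpha> c) = (\<Prod>l = 1..<m. fact (card (gap_class m \<alpha> c l)))"
proof -
  let ?q = "position m \<alpha> c" and ?G = "gap_class m \<alpha> c" and ?V = "pverts (GX m \<alpha>)"
  let ?T = "\<lambda>l. {g \<in> extensional (?G l). bij_betw g (?G l) {?q l<..<?q (Suc l)}}"
  let ?\<Phi> = "\<lambda>f. \<lambda>l\<in>{1..<m}. restrict f (?G l)"
  let ?\<Psi> = "\<lambda>h. \<lambda>v\<in>?V. case v of U i \<Rightarrow> ?q i | W i j k \<Rightarrow> h (c v) v"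
  have G: "w \<in> GX_W m \<alpha>" "c w = l" if "w \<in> ?G l" for w l
    using that by (auto simp: gap_class_def)
  have \<Psi>W: "?\<Psi> h w = h (c w) w" if "w \<in> GX_W m \<alpha>" for h w
    using that by (cases w) (auto simp: pverts_GX)
  have "bij_betw ?\<Phi> (fibre m \<alpha> c) (\<Pi>\<^sub>E l\<in>{1..<m}. ?T l)"
  proof (rule bij_betw_byWitness[where f' = ?\<Psi>])
    show "\<forall>f\<in>fibre m \<alpha> c. ?\<Psi> (?\<Phi> f) = f"
    proof
      fix f assume f: "f \<in> fibre m \<alpha> c"
      show "?\<Psi> (?\<Phi> f) = f"
      proof
        fix v
        consider "v \<notin> ?V" | i where "v = U i" "1 \<le> i" "i \<le> m" | "v \<in> GX_W m \<alpha>"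
          unfolding pverts_GX by (metis Un_iff atLeastAtMost_iff imageE)
        then show "?\<Psi> (?\<Phi> f) v = f v"
        proof cases
          case 1
          then show ?thesis using f by (simp add: fibre_def extensional_def)
        next
          case 2
          then show ?thesis using f by (auto simp: fibre_def pverts_GX)
        next
          case 3
          have "?\<Psi> (?\<Phi> f) v = ?\<Phi> f (c v) v" by (rule \<Psi>W[OF 3])
          also have "\<dots> = f v" using colouring_range[OF c 3] 3 by (simp add: gap_class_def)
          finally show ?thesis .
        qed
      qed
    qed
    show "\<forall>h\<in>\<Pi>\<^sub>E l\<in>{1..<m}. ?T l. ?\<Phi> (?\<Psi> h) = h"
    proof
      fix h assume h: "h \<in> (\<Pi>\<^sub>E l\<in>{1..<m}. ?T l)"
      show "?\<Phi> (?\<Psi> h) = h"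
      proof
        fix l
        show "?\<Phi> (?\<Psi> h) l = h l"
        proof (cases "l \<in> {1..<m}")
          case True
          then have "h l \<in> extensional (?G l)" using h by (auto simp: PiE_iff)
          moreover have "?\<Psi> h w = h l w" if "w \<in> ?G l" for w
            using \<Psi>W[of w h] G[OF that] by simp
          ultimately have "restrict (?\<Psi> h) (?G l) = h l"
            by (intro extensionalityI[of _ "?G l"]) auto
          then show ?thesis using True by simp
        next
          case False
          then show ?thesis using h by (auto simp: PiE_iff extensional_def)
        qed
      qed
    qed
    show "?\<Phi> ` fibre m \<alpha> c \<subseteq> (\<Pi>\<^sub>E l\<in>{1..<m}. ?T l)"
    proof (rule image_subsetI, rule PiE_I)
      fix f l assume f: "f \<in> fibre m \<alpha> c" and l: "l \<in> {1..<m}"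
      then have "bij_betw f (?G l) {?q l<..<?q (Suc l)}" by (auto simp: fibre_def)
      then show "?\<Phi> f l \<in> ?T l" using l by (simp add: bij_betw_restrict_eq)
    qed auto
    show "?\<Psi> ` (\<Pi>\<^sub>E l\<in>{1..<m}. ?T l) \<subseteq> fibre m \<alpha> c"
    proof (rule image_subsetI)
      fix h assume h: "h \<in> (\<Pi>\<^sub>E l\<in>{1..<m}. ?T l)"
      have "bij_betw (?\<Psi> h) (?G l) {?q l<..<?q (Suc l)}" if l: "l \<in> {1..<m}" for l
      proof (rule bij_betw_cong[THEN iffD2])
        show "?\<Psi> h w = h l w" if "w \<in> ?G l" for w
          using \<Psi>W[of w h] G[OF that] by simp
        show "bij_betw (h l) (?G l) {?q l<..<?q (Suc l)}" using h l by (auto simp: PiE_iff)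
      qed
      then show "?\<Psi> h \<in> fibre m \<alpha> c" by (simp add: fibre_def pverts_GX)
    qed
  qed
  then have "card (fibre m \<alpha> c) = card (\<Pi>\<^sub>E l\<in>{1..<m}. ?T l)" by (rule bij_betw_same_card)
  also have "\<dots> = (\<Prod>l = 1..<m. card (?T l))" by (simp add: card_PiE)
  also have "\<dots> = (\<Prod>l = 1..<m. fact (card (?G l)))"
  proof (rule prod.cong[OF refl])
    fix l assume "l \<in> {1..<m}"
    then show "card (?T l) = fact (card (?G l))"
      by (intro card_bijections) (auto simp: finite_gap_class position_Suc)
  qed
  finally show ?thesis .
qed

text \<open>The fibres partition the orderings, and a fibre has constant values on the U, so
  prescribing these values merely selects colourings.\<close>

lemma card_Topo_GX:
  assumes m: "1 \<le> m" and I: "I \<subseteq> {1..m}"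
  shows "card {f \<in> Topo (GX m \<alpha>). \<forall>i\<in>I. f (U i) = p i}
    = (\<Sum>c | c \<in> colourings m \<alpha> \<and> (\<forall>i\<in>I. position m \<alpha> c i = p i). \<Prod>l = 1..<m. fact (card (gap_class m \<alpha> c l)))"
proof -
  let ?C = "{c \<in> colourings m \<alpha>. \<forall>i\<in>I. position m \<alpha> c i = p i}"
  have "{f \<in> Topo (GX m \<alpha>). \<forall>i\<in>I. f (U i) = p i} = (\<Union>c\<in>?C. fibre m \<alpha> c)"
  proof (intro equalityI subsetI)
    fix f assume f: "f \<in> {f \<in> Topo (GX m \<alpha>). \<forall>i\<in>I. f (U i) = p i}"
    then obtain c where "c \<in> colourings m \<alpha>" "f \<in> fibre m \<alpha> c" using Topo_in_fibre by blast
    moreover from this have "\<forall>i\<in>I. position m \<alpha> c i = p i"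
      using f I by (auto simp: fibre_def) (metis atLeastAtMost_iff subsetD)
    ultimately show "f \<in> (\<Union>c\<in>?C. fibre m \<alpha> c)" by blast
  next
    fix f assume "f \<in> (\<Union>c\<in>?C. fibre m \<alpha> c)"
    then obtain c where c: "c \<in> ?C" "f \<in> fibre m \<alpha> c" by blast
    then have "f \<in> Topo (GX m \<alpha>)" using fibre_subset_Topo[OF m] by blast
    moreover have "\<forall>i\<in>I. f (U i) = p i" using c I by (fastforce simp: fibre_def)
    ultimately show "f \<in> {f \<in> Topo (GX m \<alpha>). \<forall>i\<in>I. f (U i) = p i}" by blast
  qed
  moreover have "finite (fibre m \<alpha> c)" if "c \<in> colourings m \<alpha>" for c
  proof (rule card_ge_0_finite)
    show "0 < card (fibre m \<alpha> c)" by (simp add: card_fibre[OF that] prod_pos)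
  qed
  ultimately have "card {f \<in> Topo (GX m \<alpha>). \<forall>i\<in>I. f (U i) = p i} = (\<Sum>c\<in>?C. card (fibre m \<alpha> c))"
    using finite_colourings[of m \<alpha>] by (subst card_UN_disjoint[symmetric]) (auto dest: fibre_disjoint)
  then show ?thesis by (simp add: card_fibre)
qed

section \<open>Comparison of coefficients\<close>

lemma sum_pairs_shift:
  "(\<Sum>(i, j) | 1 \<le> i \<and> i < j \<and> j \<le> m. f i j) = (\<Sum>j<m. \<Sum>i<j. f (Suc i) (Suc j) :: nat)"
proof -
  have "(\<Sum>(i, j) | 1 \<le> i \<and> i < j \<and> j \<le> m. f i j) = (\<Sum>(j, i)\<in>(SIGMA j:{..<m}. {..<j}). f (Suc i) (Suc j))"
    by (rule sum.reindex_bij_witness[where i = "\<lambda>(j, i). (Suc i, Suc j)" and j = "\<lambda>(i, j). (j - 1, i - 1)"]) auto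
  then show ?thesis by (simp add: sum.Sigma)
qed

text \<open>The lengths of the gaps open to W i j k telescope to z_j - z_i, and the index k repeats
  this factor \<alpha>_i \<alpha>_j times.\<close>

lemma prod_GX_W:
  fixes z :: "nat \<Rightarrow> real"
  shows "(\<Prod>w\<in>GX_W m \<alpha>. \<Sum>l\<in>gaps w. z (Suc l) - z l)
    = (\<Prod>j<m. \<Prod>i<j. (z (Suc j) - z (Suc i)) ^ (\<alpha> (Suc i) * \<alpha> (Suc j)))"
proof -
  have "(\<Prod>w\<in>GX_W m \<alpha>. \<Sum>l\<in>gaps w. z (Suc l) - z l)
    = (\<Prod>(j, i, k)\<in>(SIGMA j:{..<m}. SIGMA i:{..<j}. {1..\<alpha> (Suc i) * \<alpha> (Suc j)}). z (Suc j) - z (Suc i))"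
    by (rule prod.reindex_bij_witness[where i = "\<lambda>(j, i, k). W (Suc i) (Suc j) k"
        and j = "\<lambda>w. case w of W i j k \<Rightarrow> (j - 1, i - 1, k) | U i \<Rightarrow> undefined"])
      (auto simp: GX_W_def sum_Suc_diff')
  also have "\<dots> = (\<Prod>j<m. \<Prod>(i, k)\<in>(SIGMA i:{..<j}. {1..\<alpha> (Suc i) * \<alpha> (Suc j)}). z (Suc j) - z (Suc i))"
    by (subst prod.Sigma) auto
  also have "\<dots> = (\<Prod>j<m. \<Prod>i<j. \<Prod>k\<in>{1..\<alpha> (Suc i) * \<alpha> (Suc j)}. z (Suc j) - z (Suc i))"
    by (subst prod.Sigma) auto
  finally show ?thesis by simp
qed

text \<open>Multiplying out the telescoping sums chooses one gap for every W, that is, a colouring;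
  its monomial records the sizes of the gap classes.\<close>

lemma prod_differences_expand:
  fixes z :: "nat \<Rightarrow> real"
  shows "(\<Prod>j<m. \<Prod>i<j. (z (Suc j) - z (Suc i)) ^ (\<alpha> (Suc i) * \<alpha> (Suc j)))
    = (\<Sum>c\<in>colourings m \<alpha>. \<Prod>l = 1..<m. (z (Suc l) - z l) ^ card (gap_class m \<alpha> c l))"
proof -
  have fin: "finite (gaps w)" for w by (cases w) auto
  have "(\<Prod>w\<in>GX_W m \<alpha>. \<Sum>l\<in>gaps w. z (Suc l) - z l)
    = (\<Sum>c\<in>colourings m \<alpha>. \<Prod>w\<in>GX_W m \<alpha>. z (Suc (c w)) - z (c w))"
    unfolding colourings_def by (rule prod_sum_PiE) (auto simp: finite_GX_W fin)
  also have "\<dots> = (\<Sum>c\<in>colourings m \<alpha>. \<Prod>l = 1..<m. (z (Suc l) - z l) ^ card (gap_class m \<alpha> c l))"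
  proof (rule sum.cong[OF refl])
    fix c assume c: "c \<in> colourings m \<alpha>"
    have "(\<Prod>w\<in>GX_W m \<alpha>. z (Suc (c w)) - z (c w))
      = (\<Prod>l\<in>{1..<m}. \<Prod>w\<in>{w \<in> GX_W m \<alpha>. c w = l}. z (Suc (c w)) - z (c w))"
      using colouring_range[OF c] by (intro prod.group[symmetric]) (auto simp: finite_GX_W)
    also have "\<dots> = (\<Prod>l = 1..<m. (z (Suc l) - z l) ^ card (gap_class m \<alpha> c l))"
      by (simp add: gap_class_def)
    finally show "(\<Prod>w\<in>GX_W m \<alpha>. z (Suc (c w)) - z (c w))
      = (\<Prod>l = 1..<m. (z (Suc l) - z l) ^ card (gap_class m \<alpha> c l))" .
  qed
  finally show ?thesis by (simp add: prod_GX_W)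
qed

section \<open>Interleaving the points x and y\<close>

lemma prod_split_parity: "(\<Prod>i<2 * d. g i) = (\<Prod>i<d. g (2 * i) * g (Suc (2 * i)) :: 'a :: comm_monoid_mult)"
  by (induction d) (simp_all add: mult_ac)

lemma sum_split_parity: "(\<Sum>i<2 * d. g i) = (\<Sum>i<d. g (2 * i) + g (Suc (2 * i)) :: 'a :: comm_monoid_add)"
  by (induction d) (simp_all add: add_ac)

text \<open>The pairs split into x-x, y-y and mixed ones. Exponent 1 at the odd places makes the y-y
  part a plain Vandermonde product. Mixed factors are oriented later minus earlier, hence the case
  split on k and i. The induction appends y_d and then x_(d+1).\<close>

lemma prod_differences_interleaved:
  fixes x y :: "nat \<Rightarrow> real"
  assumes "\<And>i. i < d \<Longrightarrow> \<beta> (Suc (2 * i)) = 1"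
  defines "\<zeta> \<equiv> \<lambda>j. if even j then x (j div 2) else y (j div 2)"
  shows "(\<Prod>j<Suc (2 * d). \<Prod>i<j. (\<zeta> j - \<zeta> i) ^ (\<beta> i * \<beta> j))
    = (\<Prod>j<Suc d. \<Prod>i<j. (x j - x i) ^ (\<beta> (2 * i) * \<beta> (2 * j))) * (\<Prod>j<d. \<Prod>i<j. y j - y i) *
      (\<Prod>i<d. (\<Prod>k\<le>i. (y i - x k) ^ \<beta> (2 * k)) * (\<Prod>k\<in>{i<..d}. (x k - y i) ^ \<beta> (2 * k)))"
  using assms(1)
proof (induction d)
  case 0
  then show ?case by simp
next
  case (Suc d)
  have \<beta>: "\<beta> (Suc (2 * i)) = 1" if "i \<le> d" for i using Suc.prems that by simp
  have \<zeta>: "\<zeta> (2 * i) = x i" "\<zeta> (Suc (2 * i)) = y i" for i by (auto simp: \<zeta>_def)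
  have IH: "(\<Prod>j<Suc (2 * d). \<Prod>i<j. (\<zeta> j - \<zeta> i) ^ (\<beta> i * \<beta> j))
    = (\<Prod>j<Suc d. \<Prod>i<j. (x j - x i) ^ (\<beta> (2 * i) * \<beta> (2 * j))) * (\<Prod>j<d. \<Prod>i<j. y j - y i) *
      (\<Prod>i<d. (\<Prod>k\<le>i. (y i - x k) ^ \<beta> (2 * k)) * (\<Prod>k\<in>{i<..d}. (x k - y i) ^ \<beta> (2 * k)))"
    using Suc by simp
  have new_y: "(\<Prod>i<Suc (2 * d). (\<zeta> (Suc (2 * d)) - \<zeta> i) ^ (\<beta> i * \<beta> (Suc (2 * d))))
    = (\<Prod>k\<le>d. (y d - x k) ^ \<beta> (2 * k)) * (\<Prod>i<d. y d - y i)"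
    by (simp only: prod.lessThan_Suc prod_split_parity \<zeta> lessThan_Suc_atMost[symmetric])
      (simp add: \<beta> prod.distrib)
  have new_x: "(\<Prod>i<2 * Suc d. (\<zeta> (2 * Suc d) - \<zeta> i) ^ (\<beta> i * \<beta> (2 * Suc d)))
    = (\<Prod>i<Suc d. (x (Suc d) - x i) ^ (\<beta> (2 * i) * \<beta> (2 * Suc d))) * (\<Prod>i<Suc d. (x (Suc d) - y i) ^ \<beta> (2 * Suc d))"
    unfolding prod_split_parity \<zeta> prod.distrib using \<beta> by (intro arg_cong2[where f = "(*)"] prod.cong refl) auto
  have "{i<..Suc d} = insert (Suc d) {i<..d}" if "i \<le> d" for i using that by auto
  then have extend: "(\<Prod>k\<in>{i<..Suc d}. (x k - y i) ^ \<beta> (2 * k)) = (x (Suc d) - y i) ^ \<beta> (2 * Suc d) * (\<Prod>k\<in>{i<..d}. (x k - y i) ^ \<beta> (2 * k))"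
    if "i \<le> d" for i using that by simp
  have last: "(\<Prod>k\<in>{d<..d}. (x k - y d) ^ \<beta> (2 * k)) = 1" by simp
  have "(\<Prod>i<Suc d. (\<Prod>k\<le>i. (y i - x k) ^ \<beta> (2 * k)) * (\<Prod>k\<in>{i<..Suc d}. (x k - y i) ^ \<beta> (2 * k)))
    = (\<Prod>i<Suc d. (x (Suc d) - y i) ^ \<beta> (2 * Suc d) * ((\<Prod>k\<le>i. (y i - x k) ^ \<beta> (2 * k)) * (\<Prod>k\<in>{i<..d}. (x k - y i) ^ \<beta> (2 * k))))"
    by (intro prod.cong refl) (simp only: lessThan_iff less_Suc_eq_le extend mult.left_commute)
  also have "\<dots> = (\<Prod>i<Suc d. (x (Suc d) - y i) ^ \<beta> (2 * Suc d)) *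
      ((\<Prod>k\<le>d. (y d - x k) ^ \<beta> (2 * k)) *
       (\<Prod>i<d. (\<Prod>k\<le>i. (y i - x k) ^ \<beta> (2 * k)) * (\<Prod>k\<in>{i<..d}. (x k - y i) ^ \<beta> (2 * k))))"
    unfolding prod.distrib[of "\<lambda>i. (x (Suc d) - y i) ^ \<beta> (2 * Suc d)"] prod.lessThan_Suc[of _ d] last by (simp only: mult_ac mult_1_right mult_1_left)
  finally have new: "(\<Prod>i<Suc d. (\<Prod>k\<le>i. (y i - x k) ^ \<beta> (2 * k)) * (\<Prod>k\<in>{i<..Suc d}. (x k - y i) ^ \<beta> (2 * k))) = \<dots>" .
  have "2 * Suc d = Suc (Suc (2 * d))" by simp
  then have "(\<Prod>j<Suc (2 * Suc d). \<Prod>i<j. (\<zeta> j - \<zeta> i) ^ (\<beta> i * \<beta> j))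
    = (\<Prod>j<Suc (2 * d). \<Prod>i<j. (\<zeta> j - \<zeta> i) ^ (\<beta> i * \<beta> j)) *
      (\<Prod>i<Suc (2 * d). (\<zeta> (Suc (2 * d)) - \<zeta> i) ^ (\<beta> i * \<beta> (Suc (2 * d)))) *
      (\<Prod>i<2 * Suc d. (\<zeta> (2 * Suc d) - \<zeta> i) ^ (\<beta> i * \<beta> (2 * Suc d)))"
    by (simp only: prod.lessThan_Suc[of _ "Suc (2 * d)"] prod.lessThan_Suc[of _ "Suc (Suc (2 * d))"])
  also have "\<dots> = ((\<Prod>j<Suc d. \<Prod>i<j. (x j - x i) ^ (\<beta> (2 * i) * \<beta> (2 * j))) * (\<Prod>i<Suc d. (x (Suc d) - x i) ^ (\<beta> (2 * i) * \<beta> (2 * Suc d)))) *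
      ((\<Prod>j<d. \<Prod>i<j. y j - y i) * (\<Prod>i<d. y d - y i)) *
      (\<Prod>i<Suc d. (\<Prod>k\<le>i. (y i - x k) ^ \<beta> (2 * k)) * (\<Prod>k\<in>{i<..Suc d}. (x k - y i) ^ \<beta> (2 * k)))"
    unfolding new IH new_x new_y by (simp only: mult_ac)
  also have "\<dots> = (\<Prod>j<Suc (Suc d). \<Prod>i<j. (x j - x i) ^ (\<beta> (2 * i) * \<beta> (2 * j))) * (\<Prod>j<Suc d. \<Prod>i<j. y j - y i) *
      (\<Prod>i<Suc d. (\<Prod>k\<le>i. (y i - x k) ^ \<beta> (2 * k)) * (\<Prod>k\<in>{i<..Suc d}. (x k - y i) ^ \<beta> (2 * k)))"
    by (simp only: prod.lessThan_Suc[of _ "Suc d"] prod.lessThan_Suc[of "\<lambda>j. \<Prod>i<j. y j - y i" d])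
  finally show ?case .
qed

text \<open>This is the equality of the two vertex counts. With e the sum of the old even-place
  values and B the new one, both sides grow by the same amount: 2 + (e + d) + (e + d + 1) B = 1 + (e
  + d + 1) (B + 1).\<close>

lemma sum_pairs_interleaved:
  fixes \<beta> :: "nat \<Rightarrow> nat"
  assumes "\<And>i. i < d \<Longrightarrow> \<beta> (Suc (2 * i)) = 1"
  shows "Suc (2 * d) + (\<Sum>j<Suc (2 * d). \<Sum>i<j. \<beta> i * \<beta> j) = Suc d + (\<Sum>j<Suc d. \<Sum>i<j. (\<beta> (2 * i) + 1) * (\<beta> (2 * j) + 1))"
  using assms
proof (induction d)
  case (Suc d)
  define E where "E = (\<Sum>i<d. \<beta> (2 * i))"
  have e: "(\<Sum>i<2 * d. \<beta> i) = E + d"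
    unfolding sum_split_parity using Suc.prems by (simp add: E_def sum.distrib sum_Suc)
  have IH: "Suc (2 * d) + (\<Sum>j<Suc (2 * d). \<Sum>i<j. \<beta> i * \<beta> j) = Suc d + (\<Sum>j<Suc d. \<Sum>i<j. (\<beta> (2 * i) + 1) * (\<beta> (2 * j) + 1))"
    using Suc by simp
  define B where "B = \<beta> (Suc (Suc (2 * d)))"
  have \<beta>1: "\<beta> (Suc (2 * d)) = 1" using Suc.prems by simp
  have two: "2 * Suc d = Suc (Suc (2 * d))" by simp
  have new_y: "(\<Sum>i<Suc (2 * d). \<beta> i * \<beta> (Suc (2 * d))) = E + d + \<beta> (2 * d)"
    by (simp add: \<beta>1 e)
  have new_x: "(\<Sum>i<Suc (Suc (2 * d)). \<beta> i * B) = (E + d + \<beta> (2 * d) + 1) * B"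
    by (simp add: \<beta>1 e flip: sum_distrib_right)
  have new: "(\<Sum>i<Suc d. (\<beta> (2 * i) + 1) * (B + 1)) = (E + \<beta> (2 * d) + d + 1) * (B + 1)"
    by (simp only: sum_distrib_right[symmetric] sum.lessThan_Suc) (simp add: E_def sum_Suc)
  have "Suc (2 * Suc d) + (\<Sum>j<Suc (2 * Suc d). \<Sum>i<j. \<beta> i * \<beta> j)
    = 2 + (Suc (2 * d) + (\<Sum>j<Suc (2 * d). \<Sum>i<j. \<beta> i * \<beta> j)) + (\<Sum>i<Suc (2 * d). \<beta> i * \<beta> (Suc (2 * d))) + (\<Sum>i<Suc (Suc (2 * d)). \<beta> i * B)"
    unfolding two sum.lessThan_Suc[of _ "Suc (Suc (2 * d))"] sum.lessThan_Suc[of _ "Suc (2 * d)"] B_def by (simp only:)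
  also have "\<dots> = 1 + (Suc d + (\<Sum>j<Suc d. \<Sum>i<j. (\<beta> (2 * i) + 1) * (\<beta> (2 * j) + 1))) + (\<Sum>i<Suc d. (\<beta> (2 * i) + 1) * (B + 1))"
    unfolding IH new_y new_x new by (simp add: algebra_simps del: sum.lessThan_Suc)
  also have "\<dots> = Suc (Suc d) + (\<Sum>j<Suc (Suc d). \<Sum>i<j. (\<beta> (2 * i) + 1) * (\<beta> (2 * j) + 1))"
    unfolding sum.lessThan_Suc[of _ "Suc d"] two B_def by (simp only:)
  finally show ?case .
qed simp

text \<open>The Dixon--Anderson identity with both sides written in the gap lengths x_(i+1) - x_i.
  The left side integrates the colouring expansion for G_A term by term with
  \<open>pint_beta\<close>; the right side is the colouring expansion for G_B.\<close>

lemma colouring_sums_eq: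
  fixes x :: "nat \<Rightarrow> real"
  assumes even1: "\<And>i. i < d \<Longrightarrow> \<alpha> (Suc (Suc (2 * i))) = 1"
  defines "a \<equiv> \<lambda>k. \<alpha> (Suc (2 * k))"
    and "b \<equiv> \<lambda>i. \<alpha> (2 * i - 1) + 1"
    and "\<kappa> \<equiv> \<lambda>c l. card (gap_class (Suc (2 * d)) \<alpha> c l)"
  shows "(\<Sum>c\<in>colourings (Suc (2 * d)) \<alpha>.
      fact ((\<Sum>k\<le>d. a k) + d) * (\<Prod>i<d. fact (\<kappa> c (Suc (2 * i))) * fact (\<kappa> c (Suc (Suc (2 * i)))) / fact (\<kappa> c (Suc (2 * i)) + \<kappa> c (Suc (Suc (2 * i))) + 1))
      * (\<Prod>i<d. (x (Suc i) - x i) ^ (\<kappa> c (Suc (2 * i)) + \<kappa> c (Suc (Suc (2 * i))) + 1)))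
    = (\<Sum>c\<in>colourings (Suc d) b. (\<Prod>k\<le>d. fact (a k)) * (\<Prod>i<d. (x (Suc i) - x i) ^ card (gap_class (Suc d) b c (Suc i))))"
proof -
  \<comment> \<open>The sign that turns the factors (x_k - y_i)^(a_k), k > i, of the colouring
    polynomial into those of \<open>weight\<close>.\<close>
  define s where "s i = (\<Prod>k\<in>{i<..d}. (-1) ^ a k :: real)" for i
  define V where "V = (\<Prod>j<Suc d. \<Prod>i<j. (x j - x i) ^ (a i * a j))"
  \<comment> \<open>The part of a colouring monomial involving y_i: the gap 2i + 1 runs from x_i to
    y_i and the gap 2i + 2 from y_i to x_(i+1).\<close>
  define P where "P c i = [:- x i, 1:] ^ \<kappa> c (Suc (2 * i)) * [:x (Suc i), -1:] ^ \<kappa> c (Suc (Suc (2 * i)))" for c i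
  define Q where "Q \<sigma> i = smult (s i) (monom 1 (\<sigma> i) * weight x a d)" for \<sigma> :: "nat \<Rightarrow> nat" and i
  define L where "L i = pint (x i) (x (Suc i))" for i
  let ?C = "colourings (Suc (2 * d)) \<alpha>" and ?Perm = "{\<sigma>. \<sigma> permutes {0..<d}}"
  have weight_eq: "(\<Prod>k\<le>i. (t - x k) ^ a k) * (\<Prod>k\<in>{i<..d}. (x k - t) ^ a k) = s i * poly (weight x a d) t"
    if "i < d" for i t
  proof -
    have "{..d} = {..i} \<union> {i<..d}" using that by auto
    then have "poly (weight x a d) t = (\<Prod>k\<le>i. (t - x k) ^ a k) * (\<Prod>k\<in>{i<..d}. (t - x k) ^ a k)"
      unfolding weight_def poly_prod by (simp add: prod.union_disjoint[symmetric] Int_def)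
    moreover have "(\<Prod>k\<in>{i<..d}. (x k - t) ^ a k) = s i * (\<Prod>k\<in>{i<..d}. (t - x k) ^ a k)"
      unfolding s_def prod.distrib[symmetric] power_mult_distrib[symmetric] by simp
    ultimately show ?thesis by simp
  qed
  \<comment> \<open>One polynomial in the y expanded in two ways, over colourings and over the
    permutations of the Vandermonde determinant; \<open>linpoly_tensor\<close> integrates both
    expansions.\<close>
  have "(\<Sum>c\<in>?C. 1 * (\<Prod>i<d. L i (P c i))) = (\<Sum>\<sigma>\<in>?Perm. (V * signof \<sigma>) * (\<Prod>i<d. L i (Q \<sigma> i)))"
  proof (rule linpoly_tensor)
    fix y :: "nat \<Rightarrow> real"
    define \<zeta> where "\<zeta> = (\<lambda>j. if even j then x (j div 2) else y (j div 2))"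
    define z where "z l = \<zeta> (l - 1)" for l
    have \<zeta>: "\<zeta> (2 * i) = x i" "\<zeta> (Suc (2 * i)) = y i" "\<zeta> (Suc (Suc (2 * i))) = x (Suc i)" for i
      by (auto simp: \<zeta>_def)
    have "(\<Sum>c\<in>?C. 1 * (\<Prod>i<d. poly (P c i) (y i))) = (\<Sum>c\<in>?C. \<Prod>l = 1..<Suc (2 * d). (z (Suc l) - z l) ^ \<kappa> c l)"
    proof (rule sum.cong[OF refl])
      fix c
      have "(\<Prod>l = 1..<Suc (2 * d). (z (Suc l) - z l) ^ \<kappa> c l) = (\<Prod>l<2 * d. (\<zeta> (Suc l) - \<zeta> l) ^ \<kappa> c (Suc l))"
        unfolding One_nat_def prod.shift_bounds_Suc_ivl by (simp add: z_def atLeast0LessThan)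
      also have "\<dots> = (\<Prod>i<d. poly (P c i) (y i))"
        unfolding prod_split_parity \<zeta> by (simp add: P_def)
      finally show "1 * (\<Prod>i<d. poly (P c i) (y i)) = (\<Prod>l = 1..<Suc (2 * d). (z (Suc l) - z l) ^ \<kappa> c l)"
        by simp
    qed
    also have "\<dots> = (\<Prod>j<Suc (2 * d). \<Prod>i<j. (\<zeta> j - \<zeta> i) ^ (\<alpha> (Suc i) * \<alpha> (Suc j)))"
      unfolding \<kappa>_def prod_differences_expand[symmetric] by (simp add: z_def)
    also have "\<dots> = V * (\<Prod>j<d. \<Prod>i<j. y j - y i) * (\<Prod>i<d. s i * poly (weight x a d) (y i))"
    proof -
      have "(\<Prod>i<d. s i * poly (weight x a d) (y i)) = (\<Prod>i<d. (\<Prod>k\<le>i. (y i - x k) ^ a k) * (\<Prod>k\<in>{i<..d}. (x k - y i) ^ a k))"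
        by (intro prod.cong refl weight_eq[symmetric]) simp
      then show ?thesis
        unfolding V_def \<zeta>_def a_def by (simp only:) (rule prod_differences_interleaved, simp add: even1)
    qed
    also have "(\<Prod>j<d. \<Prod>i<j. y j - y i) = (\<Sum>\<sigma>\<in>?Perm. signof \<sigma> * (\<Prod>i<d. y i ^ \<sigma> i))"
      unfolding vandermonde[symmetric]
      by (subst det_def'[of _ d]) (auto simp: atLeast0LessThan permutes_in_image intro!: sum.cong prod.cong)
    also have "V * (\<Sum>\<sigma>\<in>?Perm. signof \<sigma> * (\<Prod>i<d. y i ^ \<sigma> i)) * (\<Prod>i<d. s i * poly (weight x a d) (y i))
      = (\<Sum>\<sigma>\<in>?Perm. (V * signof \<sigma>) * (\<Prod>i<d. poly (Q \<sigma> i) (y i)))"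
      unfolding sum_distrib_left sum_distrib_right
      by (intro sum.cong refl) (simp add: Q_def poly_monom prod.distrib mult_ac)
    finally show "(\<Sum>c\<in>?C. 1 * (\<Prod>i<d. poly (P c i) (y i))) = (\<Sum>\<sigma>\<in>?Perm. (V * signof \<sigma>) * (\<Prod>i<d. poly (Q \<sigma> i) (y i)))" .
  qed (simp add: L_def linpoly_pint)
  also have "\<dots> = V * ((\<Prod>i<d. s i) * dixon_anderson_det x a d)"
  proof -
    have "(\<Prod>i<d. s i) * dixon_anderson_det x a d = det (mat d d (\<lambda>(i, j). s i * L i (monom 1 j * weight x a d)))"
      unfolding dixon_anderson_det_def L_def det_scale_rows ..
    also have "\<dots> = (\<Sum>\<sigma>\<in>?Perm. signof \<sigma> * (\<Prod>i<d. L i (Q \<sigma> i)))"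
      by (subst det_def'[of _ d]) (auto simp: atLeast0LessThan permutes_in_image L_def Q_def linpoly_smult[OF linpoly_pint] intro!: sum.cong prod.cong)
    finally show ?thesis by (simp add: sum_distrib_left mult.assoc)
  qed
  finally have eq: "(\<Sum>c\<in>?C. \<Prod>i<d. L i (P c i)) = V * ((\<Prod>i<d. s i) * dixon_anderson_det x a d)" by simp
  \<comment> \<open>Exchanging the products, the factor (-1)^(a_k) occurs once for each i < k, so
    these signs cancel those in \<open>dixon_anderson\<close>.\<close>
  have "(\<Prod>i<d. s i) = (\<Prod>k\<le>d. \<Prod>i | i \<in> {..<d} \<and> i < k. (-1) ^ a k)"
    unfolding s_def using prod.swap_restrict[of "{..<d}" "{..d}" "\<lambda>i k. (-1) ^ a k" "\<lambda>i k. i < k"]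
    by (simp add: greaterThanAtMost_def greaterThan_def atMost_def Int_def conj_commute)
  also have "\<dots> = (\<Prod>k\<le>d. (-1) ^ (k * a k))"
  proof (rule prod.cong[OF refl])
    fix k assume "k \<in> {..d}"
    then have "{i. i \<in> {..<d} \<and> i < k} = {..<k}" by auto
    then show "(\<Prod>i | i \<in> {..<d} \<and> i < k. (-1 :: real) ^ a k) = (-1) ^ (k * a k)"
      by (simp add: mult.commute flip: power_mult)
  qed
  finally have signs: "(\<Prod>i<d. s i) * (\<Prod>k\<le>d. (-1) ^ (k * a k)) = 1"
    by (simp flip: prod.distrib power_mult_distrib)
  have "fact ((\<Sum>k\<le>d. a k) + d) * (\<Sum>c\<in>?C. \<Prod>i<d. L i (P c i))
    = V * (\<Prod>i<d. s i) * (dixon_anderson_det x a d * fact ((\<Sum>k\<le>d. a k) + d))"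
    unfolding eq by (simp only: mult_ac)
  also have "\<dots> = ((\<Prod>i<d. s i) * (\<Prod>k\<le>d. (-1) ^ (k * a k))) * (\<Prod>k\<le>d. fact (a k)) * (V * (\<Prod>j<Suc d. \<Prod>i<j. (x j - x i) ^ (a i + a j + 1)))"
    unfolding dixon_anderson by (simp only: mult_ac)
  \<comment> \<open>The exponents combine by a_i a_j + (a_i + a_j + 1) = (a_i + 1) (a_j + 1), which
    is where the tuple of G_B comes from.\<close>
  also have "V * (\<Prod>j<Suc d. \<Prod>i<j. (x j - x i) ^ (a i + a j + 1)) = (\<Prod>j<Suc d. \<Prod>i<j. (x j - x i) ^ (b (Suc i) * b (Suc j)))"
    unfolding V_def prod.distrib[symmetric] power_add[symmetric]
    by (intro prod.cong refl arg_cong2[where f = "(^)"]) (simp add: a_def b_def algebra_simps)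
  also have "\<dots> = (\<Sum>c\<in>colourings (Suc d) b. \<Prod>i<d. (x (Suc i) - x i) ^ card (gap_class (Suc d) b c (Suc i)))"
    using prod_differences_expand[where z = "\<lambda>l. x (l - 1)" and m = "Suc d" and \<alpha> = b]
    unfolding One_nat_def prod.shift_bounds_Suc_ivl by (simp add: atLeast0LessThan del: prod.lessThan_Suc)
  finally have "fact ((\<Sum>k\<le>d. a k) + d) * (\<Sum>c\<in>?C. \<Prod>i<d. L i (P c i))
    = (\<Prod>k\<le>d. fact (a k)) * (\<Sum>c\<in>colourings (Suc d) b. \<Prod>i<d. (x (Suc i) - x i) ^ card (gap_class (Suc d) b c (Suc i)))"
    unfolding signs by simp
  then show ?thesis
    by (simp only: L_def P_def pint_beta prod.distrib[symmetric] sum_distrib_left mult.assoc)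
qed

text \<open>The coefficient at exponents \<gamma> of the previous identity. There the beta
  denominators equal the product of the \<gamma>_i!, the same for all terms; moved to the other side
  they become the fibre sizes of G_B.\<close>

lemma weighted_colourings_eq:
  assumes even1: "\<And>i. i < d \<Longrightarrow> \<alpha> (Suc (Suc (2 * i))) = 1"
  defines "a \<equiv> \<lambda>k. \<alpha> (Suc (2 * k))"
    and "b \<equiv> \<lambda>i. \<alpha> (2 * i - 1) + 1"
    and "\<kappa> \<equiv> \<lambda>c l. card (gap_class (Suc (2 * d)) \<alpha> c l)"
    and "\<kappa>' \<equiv> \<lambda>c l. card (gap_class (Suc d) (\<lambda>i. \<alpha> (2 * i - 1) + 1) c l)"
  shows "fact ((\<Sum>k\<le>d. a k) + d) *
      (\<Sum>c | c \<in> colourings (Suc (2 * d)) \<alpha> \<and> (\<forall>i<d. \<kappa> c (Suc (2 * i)) + \<kappa> c (Suc (Suc (2 * i))) + 1 = \<gamma> i). \<Prod>l = 1..<Suc (2 * d). fact (\<kappa> c l))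
    = (\<Prod>k\<le>d. fact (a k)) * (\<Sum>c | c \<in> colourings (Suc d) b \<and> (\<forall>i<d. \<kappa>' c (Suc i) = \<gamma> i). \<Prod>l = 1..<Suc d. fact (\<kappa>' c l) :: nat)"
proof -
  let ?CA = "{c. c \<in> colourings (Suc (2 * d)) \<alpha> \<and> (\<forall>i<d. \<kappa> c (Suc (2 * i)) + \<kappa> c (Suc (Suc (2 * i))) + 1 = \<gamma> i)}"
  let ?CB = "{c. c \<in> colourings (Suc d) b \<and> (\<forall>i<d. \<kappa>' c (Suc i) = \<gamma> i)}"
  let ?S = "fact ((\<Sum>k\<le>d. a k) + d) :: real" and ?F = "\<Prod>k\<le>d. fact (a k) :: real" and ?G = "\<Prod>i<d. fact (\<gamma> i) :: real"
  have "(\<Sum>c | c \<in> colourings (Suc (2 * d)) \<alpha> \<and> (\<forall>i<d. \<kappa> c (Suc (2 * i)) + \<kappa> c (Suc (Suc (2 * i))) + 1 = \<gamma> i).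
      ?S * (\<Prod>i<d. fact (\<kappa> c (Suc (2 * i))) * fact (\<kappa> c (Suc (Suc (2 * i)))) / fact (\<kappa> c (Suc (2 * i)) + \<kappa> c (Suc (Suc (2 * i))) + 1)))
    = (\<Sum>c\<in>?CB. ?F)"
  proof (rule monomial_sums_eq_imp_coeffs_eq)
    \<comment> \<open>Taking the x to be partial sums of \<open>t\<close> makes the gap lengths the
      independent variables t_i.\<close>
    fix t :: "nat \<Rightarrow> real"
    show "(\<Sum>c\<in>colourings (Suc (2 * d)) \<alpha>.
        ?S * (\<Prod>i<d. fact (\<kappa> c (Suc (2 * i))) * fact (\<kappa> c (Suc (Suc (2 * i)))) / fact (\<kappa> c (Suc (2 * i)) + \<kappa> c (Suc (Suc (2 * i))) + 1))
        * (\<Prod>i<d. t i ^ (\<kappa> c (Suc (2 * i)) + \<kappa> c (Suc (Suc (2 * i))) + 1)))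
      = (\<Sum>c\<in>colourings (Suc d) b. ?F * (\<Prod>i<d. t i ^ \<kappa>' c (Suc i)))"
      using colouring_sums_eq[of d \<alpha> "\<lambda>i. \<Sum>l<i. t l"] even1
      by (simp only: a_def b_def \<kappa>_def \<kappa>'_def sum.lessThan_Suc add_diff_cancel_left')
  qed (auto simp: finite_colourings)
  also have "(\<Sum>c\<in>?CA. ?S * (\<Prod>i<d. fact (\<kappa> c (Suc (2 * i))) * fact (\<kappa> c (Suc (Suc (2 * i)))) / fact (\<kappa> c (Suc (2 * i)) + \<kappa> c (Suc (Suc (2 * i))) + 1)))
    = ?S * (\<Sum>c\<in>?CA. \<Prod>l = 1..<Suc (2 * d). fact (\<kappa> c l)) / ?G"
    unfolding sum_distrib_left sum_divide_distrib
  proof (rule sum.cong[OF refl])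
    fix c assume "c \<in> ?CA"
    then have \<gamma>: "\<kappa> c (Suc (2 * i)) + \<kappa> c (Suc (Suc (2 * i))) + 1 = \<gamma> i" if "i < d" for i
      using that by blast
    then have "(\<Prod>i<d. fact (\<kappa> c (Suc (2 * i))) * fact (\<kappa> c (Suc (Suc (2 * i)))) / fact (\<kappa> c (Suc (2 * i)) + \<kappa> c (Suc (Suc (2 * i))) + 1))
      = (\<Prod>i<d. fact (\<kappa> c (Suc (2 * i))) * fact (\<kappa> c (Suc (Suc (2 * i)))) / fact (\<gamma> i) :: real)"
      by (intro prod.cong refl) (simp only: lessThan_iff \<gamma>)
    also have "\<dots> = (\<Prod>l = 1..<Suc (2 * d). fact (\<kappa> c l)) / ?G"
      unfolding prod_dividef One_nat_def prod.shift_bounds_Suc_ivl atLeast0LessThan prod_split_parity ..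
    finally show "?S * (\<Prod>i<d. fact (\<kappa> c (Suc (2 * i))) * fact (\<kappa> c (Suc (Suc (2 * i)))) / fact (\<kappa> c (Suc (2 * i)) + \<kappa> c (Suc (Suc (2 * i))) + 1))
      = ?S * (\<Prod>l = 1..<Suc (2 * d). fact (\<kappa> c l)) / ?G" by simp
  qed
  finally have "?S * (\<Sum>c\<in>?CA. \<Prod>l = 1..<Suc (2 * d). fact (\<kappa> c l)) = (\<Sum>c\<in>?CB. ?F) * ?G"
    by (simp add: field_simps)
  also have "\<dots> = ?F * (\<Sum>c\<in>?CB. ?G)" by simp
  \<comment> \<open>On these colourings the gap sizes are the \<gamma>_i, so the cleared denominator
    is the fibre size.\<close>
  also have "(\<Sum>c\<in>?CB. ?G) = (\<Sum>c\<in>?CB. \<Prod>l = 1..<Suc d. fact (\<kappa>' c l))"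
    unfolding One_nat_def prod.shift_bounds_Suc_ivl atLeast0LessThan by (intro sum.cong prod.cong) auto
  finally have "real (fact ((\<Sum>k\<le>d. a k) + d) * (\<Sum>c\<in>?CA. \<Prod>l = 1..<Suc (2 * d). fact (\<kappa> c l)))
    = real ((\<Prod>k\<le>d. fact (a k)) * (\<Sum>c\<in>?CB. \<Prod>l = 1..<Suc d. fact (\<kappa>' c l)))"
    by (simp only: of_nat_mult of_nat_sum of_nat_prod of_nat_fact)
  then show ?thesis by (simp only: of_nat_eq_iff)
qed

section \<open>Prescribed positions as prescribed gap sizes\<close>

lemma partial_sums_eq_iff:
  fixes g \<gamma> :: "nat \<Rightarrow> nat"
  shows "(\<forall>k\<le>d. Suc (\<Sum>l<k. Suc (g l)) = Suc (\<Sum>l<k. Suc (\<gamma> l))) \<longleftrightarrow> (\<forall>l<d. g l = \<gamma> l)"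
proof (intro iffI allI impI)
  fix l assume eq: "\<forall>k\<le>d. Suc (\<Sum>l<k. Suc (g l)) = Suc (\<Sum>l<k. Suc (\<gamma> l))" and l: "l < d"
  show "g l = \<gamma> l"
    using eq[rule_format, of l] eq[rule_format, of "Suc l"] l by simp
next
  fix k assume "\<forall>l<d. g l = \<gamma> l" "k \<le> d"
  then show "Suc (\<Sum>l<k. Suc (g l)) = Suc (\<Sum>l<k. Suc (\<gamma> l))" by simp
qed

text \<open>Between consecutive odd U lie two gaps and one even U; the summand + 1 for the latter
  matches the exponent of the beta integral.\<close>

lemma position_odd:
  "position m \<alpha> c (Suc (2 * k))
    = Suc (\<Sum>l<k. Suc (card (gap_class m \<alpha> c (Suc (2 * l))) + card (gap_class m \<alpha> c (Suc (Suc (2 * l)))) + 1))"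
proof -
  have "position m \<alpha> c (Suc (2 * k)) = Suc (2 * k) + (\<Sum>l<2 * k. card (gap_class m \<alpha> c (Suc l)))"
    unfolding position_def One_nat_def sum.shift_bounds_Suc_ivl atLeast0LessThan ..
  then show ?thesis
    unfolding sum_split_parity by (simp add: sum_Suc)
qed

lemma position_eq_partial_sum:
  "position m \<alpha> c (Suc k) = Suc (\<Sum>l<k. Suc (card (gap_class m \<alpha> c (Suc l))))"
  unfolding position_def One_nat_def sum.shift_bounds_Suc_ivl atLeast0LessThan by (simp add: sum_Suc)

lemma card_Topo_eq:
  fixes p :: "nat \<Rightarrow> nat"
  assumes even1: "\<And>i. i < d \<Longrightarrow> \<alpha> (Suc (Suc (2 * i))) = 1"
  shows "fact ((\<Sum>k\<le>d. \<alpha> (Suc (2 * k))) + d) * card {f \<in> Topo (GX (Suc (2 * d)) \<alpha>). \<forall>k\<le>d. f (U (Suc (2 * k))) = p k}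
    = (\<Prod>k\<le>d. fact (\<alpha> (Suc (2 * k)))) * card {f \<in> Topo (GX (Suc d) (\<lambda>i. \<alpha> (2 * i - 1) + 1)). \<forall>k\<le>d. f (U (Suc k)) = p k}"
proof -
  let ?mA = "Suc (2 * d)" and ?mB = "Suc d" and ?b = "\<lambda>i. \<alpha> (2 * i - 1) + 1"
  let ?gA = "\<lambda>c l. card (gap_class ?mA \<alpha> c (Suc (2 * l))) + card (gap_class ?mA \<alpha> c (Suc (Suc (2 * l)))) + 1"
  let ?gB = "\<lambda>c l. card (gap_class ?mB ?b c (Suc l))"
  let ?pos = "\<lambda>g k. Suc (\<Sum>l<k. Suc (g l)) :: nat"
  have cA: "card {f \<in> Topo (GX ?mA \<alpha>). \<forall>k\<le>d. f (U (Suc (2 * k))) = p k}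
    = (\<Sum>c | c \<in> colourings ?mA \<alpha> \<and> (\<forall>k\<le>d. ?pos (?gA c) k = p k). \<Prod>l = 1..<?mA. fact (card (gap_class ?mA \<alpha> c l)))"
  proof -
    have I: "(\<lambda>k. Suc (2 * k)) ` {..d} \<subseteq> {1..?mA}" by auto
    have ball: "(\<forall>i\<in>(\<lambda>k. Suc (2 * k)) ` {..d}. Q i) \<longleftrightarrow> (\<forall>k\<le>d. Q (Suc (2 * k)))" for Q by auto
    \<comment> \<open>The prescription is indexed by k but attached to the vertex U (2k + 1);
      \<open>i div 2\<close> recovers k.\<close>
    have half: "Suc (2 * k) div 2 = k" for k by simp
    show ?thesis
      by (rule card_Topo_GX[OF _ I, of \<alpha> "\<lambda>i. p (i div 2)", unfolded ball position_odd half]) simp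
  qed
  have cB: "card {f \<in> Topo (GX ?mB ?b). \<forall>k\<le>d. f (U (Suc k)) = p k}
    = (\<Sum>c | c \<in> colourings ?mB ?b \<and> (\<forall>k\<le>d. ?pos (?gB c) k = p k). \<Prod>l = 1..<?mB. fact (card (gap_class ?mB ?b c l)))"
  proof -
    have I: "Suc ` {..d} \<subseteq> {1..?mB}" by auto
    have ball: "(\<forall>i\<in>Suc ` {..d}. Q i) \<longleftrightarrow> (\<forall>k\<le>d. Q (Suc k))" for Q by auto
    show ?thesis
      by (rule card_Topo_GX[OF _ I, of ?b "\<lambda>i. p (i - 1)", unfolded ball position_eq_partial_sum diff_Suc_1]) simp
  qed
  show ?thesis
  proof (cases "\<exists>\<gamma>. \<forall>k\<le>d. ?pos \<gamma> k = p k")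
    case True
    then obtain \<gamma> where \<gamma>: "p k = ?pos \<gamma> k" if "k \<le> d" for k by metis
    have eq: "(\<forall>k\<le>d. ?pos g k = p k) \<longleftrightarrow> (\<forall>l<d. g l = \<gamma> l)" for g
      unfolding partial_sums_eq_iff[symmetric] by (simp add: \<gamma>)
    show ?thesis
      unfolding cA cB eq by (rule weighted_colourings_eq) (rule even1)
  next
    \<comment> \<open>No gap sizes realise \<open>p\<close>, for instance when \<open>p\<close> is
      not increasing; then both sums are empty.\<close>
    case False
    then have none: "\<not> (\<forall>k\<le>d. ?pos g k = p k)" for g by blast
    show ?thesis
      unfolding cA cB by (simp only: none simp_thms empty_def[symmetric] sum.empty mult_0_right)
  qed
qed

lemma finite_Topo_GX: "finite (Topo (GX m \<alpha>))"
proof (rule finite_subset)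
  let ?V = "pverts (GX m \<alpha>)"
  show "Topo (GX m \<alpha>) \<subseteq> (\<Pi>\<^sub>E v\<in>?V. {1..card ?V})"
    by (auto simp: Topo_def PiE_def bij_betw_def)
  show "finite (\<Pi>\<^sub>E v\<in>?V. {1..card ?V})"
    using finite_pverts_GX by (intro finite_PiE) auto
qed

theorem theorem2p2:
  fixes n N :: nat and \<alpha> p :: "nat \<Rightarrow> nat"
    and GA GB :: "gx_vertex pair_pre_digraph"
    and A B :: "(gx_vertex \<Rightarrow> nat) set"
  assumes "n \<ge> 1"
    and "\<forall>i \<in> {1..2 * n - 1}. even i \<longrightarrow> \<alpha> i = 1"
    and "GA = GX (2 * n - 1) \<alpha>"
    and "GB = GX n (\<lambda>i. \<alpha> (2 * i - 1) + 1)"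
    and "N = n + (\<Sum>(i, j) | 1 \<le> i \<and> i < j \<and> j \<le> n. (\<alpha> (2 * i - 1) + 1) * (\<alpha> (2 * j - 1) + 1))"
    and "\<forall>i \<in> {1..2 * n - 1}. odd i \<longrightarrow> p i \<in> {1..N}"
    and "inj_on p {i \<in> {1..2 * n - 1}. odd i}"
    and "A = {f \<in> Topo GA. \<forall>i \<in> {1..2 * n - 1}. odd i \<longrightarrow> f (U i) = p i}"
    and "B = {f \<in> Topo GB. \<forall>i \<in> {1..n}. f (U i) = p (2 * i - 1)}"
  shows "card (pverts GA) = N \<and> card (pverts GB) = N \<and>
    (\<exists>F. bij_betw F
      ({1..fact (\<Sum>i = 1..2 * n - 1. \<alpha> i) :: nat} \<times> A)
      ((\<Pi>\<^sub>E i \<in> {1..2 * n - 1}. {1..fact (\<alpha> i) :: nat}) \<times> B))"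
proof -
  obtain d where n: "n = Suc d" using assms(1) by (cases n) auto
  have m: "2 * n - 1 = Suc (2 * d)" using n by simp
  have even1: "\<alpha> (Suc (Suc (2 * i))) = 1" if "i < d" for i
    using assms(2) that unfolding m by auto
  have GA: "GA = GX (Suc (2 * d)) \<alpha>" and GB: "GB = GX (Suc d) (\<lambda>i. \<alpha> (2 * i - 1) + 1)"
    using assms(3,4) unfolding m n by auto
  have cardB: "card (pverts GB) = N"
    unfolding GB card_pverts_GX assms(5) n ..
  have "card (pverts GA) = Suc (2 * d) + (\<Sum>j<Suc (2 * d). \<Sum>i<j. \<alpha> (Suc i) * \<alpha> (Suc j))"
    unfolding GA card_pverts_GX sum_pairs_shift ..
  also have "\<dots> = Suc d + (\<Sum>j<Suc d. \<Sum>i<j. (\<alpha> (Suc (2 * i)) + 1) * (\<alpha> (Suc (2 * j)) + 1))"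
    by (rule sum_pairs_interleaved) (rule even1)
  also have "\<dots> = N"
    unfolding assms(5) n sum_pairs_shift by (simp del: sum.lessThan_Suc)
  finally have cardA: "card (pverts GA) = N" .

  have odd_iff: "(\<forall>i\<in>{1..Suc (2 * d)}. odd i \<longrightarrow> Q i) \<longleftrightarrow> (\<forall>k\<le>d. Q (Suc (2 * k)))" for Q
    by (auto elim!: oddE)
  have A: "A = {f \<in> Topo (GX (Suc (2 * d)) \<alpha>). \<forall>k\<le>d. f (U (Suc (2 * k))) = p (Suc (2 * k))}"
    unfolding assms(8) m GA odd_iff ..
  have Suc_iff: "(\<forall>i\<in>{1..Suc d}. Q i) \<longleftrightarrow> (\<forall>k\<le>d. Q (Suc k))" for Q
  proof safe
    fix i assume Q: "\<forall>k\<le>d. Q (Suc k)" and i: "i \<in> {1..Suc d}"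
    then show "Q i" using Q[rule_format, of "i - 1"] by auto
  qed auto
  have B: "B = {f \<in> Topo (GX (Suc d) (\<lambda>i. \<alpha> (2 * i - 1) + 1)). \<forall>k\<le>d. f (U (Suc k)) = p (Suc (2 * k))}"
    unfolding assms(9) n GB Suc_iff by simp
  \<comment> \<open>Each of the d even indices contributes 1 to the sum here and the factor 1! to
    the product below.\<close>
  have "(\<Sum>i = 1..2 * n - 1. \<alpha> i) = (\<Sum>i<Suc (2 * d). \<alpha> (Suc i))"
    unfolding m unfolding One_nat_def atLeastLessThanSuc_atLeastAtMost[symmetric] sum.shift_bounds_Suc_ivl atLeast0LessThan ..
  also have "\<dots> = (\<Sum>k\<le>d. \<alpha> (Suc (2 * k))) + d"
    by (simp add: sum_split_parity even1 sum_Suc flip: lessThan_Suc_atMost)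
  finally have S: "(\<Sum>i = 1..2 * n - 1. \<alpha> i) = (\<Sum>k\<le>d. \<alpha> (Suc (2 * k))) + d" .
  have "(\<Prod>i = 1..2 * n - 1. fact (\<alpha> i)) = (\<Prod>i<Suc (2 * d). fact (\<alpha> (Suc i)) :: nat)"
    unfolding m unfolding One_nat_def atLeastLessThanSuc_atLeastAtMost[symmetric] prod.shift_bounds_Suc_ivl atLeast0LessThan ..
  also have "\<dots> = (\<Prod>k\<le>d. fact (\<alpha> (Suc (2 * k))))"
    by (simp add: prod_split_parity even1 flip: lessThan_Suc_atMost)
  finally have P: "(\<Prod>i = 1..2 * n - 1. fact (\<alpha> i)) = (\<Prod>k\<le>d. fact (\<alpha> (Suc (2 * k))) :: nat)" .
  have "fact (\<Sum>i = 1..2 * n - 1. \<alpha> i) * card A = (\<Prod>i = 1..2 * n - 1. fact (\<alpha> i)) * card B"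
    unfolding S P A B using card_Topo_eq[of d \<alpha> "\<lambda>k. p (Suc (2 * k))"] even1 by blast
  then have "card ({1..fact (\<Sum>i = 1..2 * n - 1. \<alpha> i) :: nat} \<times> A)
    = card ((\<Pi>\<^sub>E i \<in> {1..2 * n - 1}. {1..fact (\<alpha> i) :: nat}) \<times> B)"
    by (simp add: card_cartesian_product card_PiE)
  \<comment> \<open>Finiteness turns the equality of cardinalities into a bijection, which is
    therefore not an explicit one.\<close>
  moreover have "finite A" "finite B"
    unfolding A B using finite_Topo_GX by auto
  ultimately have "\<exists>F. bij_betw F ({1..fact (\<Sum>i = 1..2 * n - 1. \<alpha> i) :: nat} \<times> A)
      ((\<Pi>\<^sub>E i \<in> {1..2 * n - 1}. {1..fact (\<alpha> i) :: nat}) \<times> B)"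
    by (intro finite_same_card_bij) (auto intro!: finite_PiE)
  then show ?thesis using cardA cardB by blast
qed

end
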